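(* Let $(\mathcal A,\varphi,\psi,\theta)$ be a unital 3-algebraic probability space. Let $\{a_i\}_{i=1}^\infty$ be identically distributed $\alpha$-free elements of $\mathcal A$ (index set $\mathbb N$ with its usual order) such that $\varphi(a_i)=\psi(a_i)=\theta(a_i)=0$. Set $u:=\varphi(a_i^2)$, $v:=\psi(a_i^2)$, $w:=\theta(a_i^2)$ and $s_n:=\frac{a_1+a_2+\cdots+a_n}{\sqrt n}$. Then, as $n\to\infty$, the distribution of $s_n$ with respect to $(\varphi,\psi,\theta)$ converges to the triplet of distributions $(\lambda^{(u,v,w)},\mu^{(v,w)},\nu^{(v,w)})$ determined by $$\lambda^{(u,v,w)}(x^{2p-1})=0,\qquad \lambda^{(u,v,w)}(x^{2p})=\sum_{\pi\in\mathcal{ONC}_{\rm pair}(2p)}\frac1{p!}\,u^{\#\mathscr O(\pi)}v^{\#\mathscr B(\pi)}w^{\#\mathscr C(\pi)}\qquad(p\in\mathbb N),$$ $$\mu^{(v,w)}=\lambda^{(v,v,w)},\qquad \nu^{(v,w)}=\lambda^{(w,v,w)}.$$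
   Context: Algebras are over $\mathbb C$. A unital 3-algebraic probability space is a unital algebra with three unital linear functionals. A distribution is a unital linear functional on $\mathbb C[x]$. The distribution of $a\in\mathcal A$ is the triplet $(\lambda,\mu,\nu)$ with $\lambda(x^n)=\varphi(a^n)$, $\mu(x^n)=\psi(a^n)$, $\nu(x^n)=\theta(a^n)$; elements are identically distributed if they have the same distribution. A sequence of triplets $(\lambda^n,\mu^n,\nu^n)$ converges to $(\lambda,\mu,\nu)$ if $(\lambda^n(x^k),\mu^n(x^k),\nu^n(x^k))\to(\lambda(x^k),\mu(x^k),\nu(x^k))$ for every $k\in\mathbb N$. **$\alpha$-freeness.** For a totally ordered set $I$, $I^\ast$ is the set of finite sequences $\mathbf i=(i_1,\dots,i_n)$, $n\ge1$, in $I$ with $i_k\ne i_{k+1}$. $\mathrm{Peak}(\mathbf i)=\{k\in\{2,\dots,n-1\}: i_{k-1}<i_k>i_{k+1}\}$, $\mathrm{Bot}(\mathbf i)=\{k\in\{2,\dots,n-1\}: i_{k-1}>i_k<i_{k+1}\}$. Define linear functionals $\alpha_{\mathbf i,k}$ on $\mathcal A$: $\alpha_{\mathbf i,1}=\varphi$, $\alpha_{\mathbf i,k}=\psi$ if $k\in\mathrm{Peak}(\mathbf i)$, $\theta$ if $k\in\mathrm{Bot}(\mathbf i)$, $0$ otherwise; $\beta_{\mathbf i,k}$ (resp. $\gamma_{\mathbf i,k}$) is the same except that $\beta_{\mathbf i,1}=\psi$ (resp. $\gamma_{\mathbf i,1}=\theta$). Subalgebras $\{\mathcal A_i\}_{i\in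 I}$ of $\mathcal A$ containing the unit are $\alpha$-free if for every $\mathbf i\in I^\ast$ and $b_k\in\mathcal A_{i_k}$: $\varphi(b_1\cdots b_n)=0$ whenever $b_k\in\ker\alpha_{\mathbf i,k}$ for all $k$; $\psi(b_1\cdots b_n)=0$ whenever $b_k\in\ker\beta_{\mathbf i,k}$ for all $k$; $\theta(b_1\cdots b_n)=0$ whenever $b_k\in\ker\gamma_{\mathbf i,k}$ for all $k$. Elements $\{a_i\}_{i\in I}$ are $\alpha$-free if the unital subalgebras generated by the $a_i$ are. **Partitions.** An ordered set partition of $[n]$ is a sequence $\pi=(P_1,\dots,P_p)$ whose entries form a set partition of $[n]$; $P_i$ precedes $P_j$ if $i<j$. $\mathcal{ONC}(n)$ is the set of those whose underlying set partition is noncrossing, and $\mathcal{ONC}_{\rm pair}(n)$ the subset where every block has cardinality two. A block $P'$ covers $P$ if there are $i,j\in P'$ with $i<k<j$ for all $k\in P$. Blocks covered by another block are inner, the others outer; $\mathscr O(\pi)$ is the set of outer blocks. The nearest cover $C(P)$ of an inner block $P$ is the unique block covering $P$ such that no block $P'$ covers $P$ and is covered by $C(P)$. $\mathscr B(\pi)$ = set of inner blocks $P$ such that $C(P)$ precedes $P$; $\mathscr C(\pi)$ = set of inner blocks $P$ that precede $C(P)$. *)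

theory Defs
  imports Complex_Main "HOL-Computational_Algebra.Polynomial" "HOL-Library.Disjoint_Sets"
begin

section \<open>Unital 3-algebraic probability spaces\<close>

locale unital_complex_algebra = vector_space sc
  for sc :: "complex \<Rightarrow> 'a::ring_1 \<Rightarrow> 'a" +
  assumes scale_mult_left: "sc c x * y = sc c (x * y)"
    and scale_mult_right: "x * sc c y = sc c (x * y)"

definition unital_functional :: "(complex \<Rightarrow> 'a::ring_1 \<Rightarrow> 'a) \<Rightarrow> ('a \<Rightarrow> complex) \<Rightarrow> bool" where
  "unital_functional sc f \<longleftrightarrow> Vector_Spaces.linear sc (*) f \<and> f 1 = 1"

locale three_prob_space = unital_complex_algebra sc
  for sc :: "complex \<Rightarrow> 'a::ring_1 \<Rightarrow> 'a" +
  fixes \<phi> \<psi> \<theta> :: "'a \<Rightarrow> complex"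
  assumes unital_phi: "unital_functional sc \<phi>"
    and unital_psi: "unital_functional sc \<psi>"
    and unital_theta: "unital_functional sc \<theta>"

definition unital_subalgebra :: "(complex \<Rightarrow> 'a::ring_1 \<Rightarrow> 'a) \<Rightarrow> 'a set \<Rightarrow> bool" where
  "unital_subalgebra sc S \<longleftrightarrow>
     module.subspace sc S \<and> 1 \<in> S \<and> (\<forall>x\<in>S. \<forall>y\<in>S. x * y \<in> S)"

definition generated_subalgebra :: "(complex \<Rightarrow> 'a::ring_1 \<Rightarrow> 'a) \<Rightarrow> 'a \<Rightarrow> 'a set" where
  "generated_subalgebra sc a = \<Inter>{S. unital_subalgebra sc S \<and> a \<in> S}"

section \<open>Distributions\<close>

text \<open>Distributions are the unital linear functionals on complex polynomials.\<close>

type_synonym functional = "complex poly \<Rightarrow> complex"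

definition is_distribution :: "functional \<Rightarrow> bool" where
  "is_distribution L \<longleftrightarrow> unital_functional smult L"

text \<open>The linear functional with prescribed values \<open>m n\<close> on the monomials \<open>x ^ n\<close>.\<close>

definition functional_of_moments :: "(nat \<Rightarrow> complex) \<Rightarrow> functional" where
  "functional_of_moments m p = (\<Sum>i\<le>degree p. coeff p i * m i)"

lemma functional_of_moments_altdef:
  assumes "degree p \<le> n"
  shows "functional_of_moments m p = (\<Sum>i\<le>n. coeff p i * m i)"
  unfolding functional_of_moments_def
  by (rule sum.mono_neutral_left) (use assms in \<open>auto simp: coeff_eq_0\<close>)

lemma functional_of_moments_monom [simp]: "functional_of_moments m (monom 1 n) = m n"
proof -
  have "functional_of_moments m (monom 1 n) = (\<Sum>i\<le>n. if n = i then m i else 0)"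
    unfolding functional_of_moments_def by (rule sum.cong) (auto simp: degree_monom_eq)
  thus ?thesis by simp
qed

lemma is_distribution_functional_of_moments:
  assumes "m 0 = 1"
  shows "is_distribution (functional_of_moments m)"
proof -
  have add: "functional_of_moments m (p + q) = functional_of_moments m p + functional_of_moments m q"
    for p q
  proof -
    define n where "n = max (degree p) (degree q)"
    have "degree p \<le> n" "degree q \<le> n" "degree (p + q) \<le> n"
      by (auto simp: n_def degree_add_le_max)
    thus ?thesis
      by (simp add: functional_of_moments_altdef[of _ n] ring_distribs sum.distrib)
  qed
  have smult: "functional_of_moments m (smult c p) = c * functional_of_moments m p" for c p
    by (simp add: functional_of_moments_altdef[of _ "degree p"] degree_smult_le
        sum_distrib_left mult.assoc)
  have "Vector_Spaces.linear smult (*) (functional_of_moments m)"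
    by (unfold_locales) (auto simp: add smult algebra_simps smult_add_right smult_add_left)
  moreover have "functional_of_moments m 1 = 1"
    using assms functional_of_moments_monom[of m 0] by (simp flip: one_poly_eq_simps)
  ultimately show ?thesis
    by (simp add: is_distribution_def unital_functional_def)
qed

lemma is_distribution_eq_functional_of_moments:
  assumes "is_distribution L" and "\<And>n. L (monom 1 n) = m n"
  shows "L = functional_of_moments m"
proof
  fix p
  interpret L: Vector_Spaces.linear smult "(*)" L
    using assms(1) by (simp add: is_distribution_def unital_functional_def)
  have "L p = L (\<Sum>i\<le>degree p. smult (coeff p i) (monom 1 i))"
    by (simp add: smult_monom poly_as_sum_of_monoms)
  also have "\<dots> = functional_of_moments m p"
    by (simp only: L.sum L.scale assms(2) functional_of_moments_def)
  finally show "L p = functional_of_moments m p" .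
qed

definition distr :: "('a::ring_1 \<Rightarrow> complex) \<Rightarrow> 'a \<Rightarrow> functional" where
  "distr f a = functional_of_moments (\<lambda>n. f (a ^ n))"

definition distr3 ::
  "('a::ring_1 \<Rightarrow> complex) \<Rightarrow> ('a \<Rightarrow> complex) \<Rightarrow> ('a \<Rightarrow> complex) \<Rightarrow> 'a
    \<Rightarrow> functional \<times> functional \<times> functional" where
  "distr3 \<phi> \<psi> \<theta> a = (distr \<phi> a, distr \<psi> a, distr \<theta> a)"

definition identically_distributed ::
  "('a::ring_1 \<Rightarrow> complex) \<Rightarrow> ('a \<Rightarrow> complex) \<Rightarrow> ('a \<Rightarrow> complex) \<Rightarrow> 'i set \<Rightarrow> ('i \<Rightarrow> 'a) \<Rightarrow> bool" where
  "identically_distributed \<phi> \<psi> \<theta> I a \<longleftrightarrow>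
     (\<forall>i\<in>I. \<forall>j\<in>I. distr3 \<phi> \<psi> \<theta> (a i) = distr3 \<phi> \<psi> \<theta> (a j))"

fun converges3 ::
  "(nat \<Rightarrow> functional \<times> functional \<times> functional) \<Rightarrow> functional \<times> functional \<times> functional \<Rightarrow> bool" where
  "converges3 T (L, M, N) \<longleftrightarrow>
     (\<forall>k. (\<lambda>n. fst (T n) (monom 1 k)) \<longlonglongrightarrow> L (monom 1 k) \<and>
          (\<lambda>n. fst (snd (T n)) (monom 1 k)) \<longlonglongrightarrow> M (monom 1 k) \<and>
          (\<lambda>n. snd (snd (T n)) (monom 1 k)) \<longlonglongrightarrow> N (monom 1 k))"

section \<open>\<open>\<alpha>\<close>-freeness\<close>

text \<open>
  Index sequences are lists, so positions are counted from 0: the first position is 0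
  and the interior positions are those \<open>k\<close> with \<open>0 < k\<close> and \<open>Suc k < length js\<close>.
\<close>

definition alternating :: "'i set \<Rightarrow> 'i list set" where
  "alternating I = {js. js \<noteq> [] \<and> set js \<subseteq> I \<and> distinct_adj js}"

definition Peak :: "'i::linorder list \<Rightarrow> nat set" where
  "Peak js = {k. 0 < k \<and> Suc k < length js \<and> js ! (k - 1) < js ! k \<and> js ! k > js ! Suc k}"

definition Bot :: "'i::linorder list \<Rightarrow> nat set" where
  "Bot js = {k. 0 < k \<and> Suc k < length js \<and> js ! (k - 1) > js ! k \<and> js ! k < js ! Suc k}"

text \<open>
  \<open>word_functional \<chi> \<psi> \<theta>\<close> is the family \<open>\<alpha>\<close>, \<open>\<beta>\<close> or \<open>\<gamma>\<close> when the functional \<open>\<chi>\<close> at the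
  first position is \<open>\<phi>\<close>, \<open>\<psi>\<close> or \<open>\<theta>\<close>, respectively.
\<close>

definition word_functional ::
  "('a \<Rightarrow> complex) \<Rightarrow> ('a \<Rightarrow> complex) \<Rightarrow> ('a \<Rightarrow> complex) \<Rightarrow> 'i::linorder list \<Rightarrow> nat \<Rightarrow> 'a \<Rightarrow> complex" where
  "word_functional \<chi> \<psi> \<theta> js k =
     (if k = 0 then \<chi> else if k \<in> Peak js then \<psi> else if k \<in> Bot js then \<theta> else (\<lambda>_. 0))"

definition alpha_free_subalgebras ::
  "(complex \<Rightarrow> 'a::ring_1 \<Rightarrow> 'a) \<Rightarrow> ('a \<Rightarrow> complex) \<Rightarrow> ('a \<Rightarrow> complex) \<Rightarrow> ('a \<Rightarrow> complex)
    \<Rightarrow> 'i::linorder set \<Rightarrow> ('i \<Rightarrow> 'a set) \<Rightarrow> bool" where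
  "alpha_free_subalgebras sc \<phi> \<psi> \<theta> I A \<longleftrightarrow>
     (\<forall>i\<in>I. unital_subalgebra sc (A i)) \<and>
     (\<forall>js\<in>alternating I. \<forall>bs. length bs = length js \<and> (\<forall>k<length js. bs ! k \<in> A (js ! k)) \<longrightarrow>
        ((\<forall>k<length js. word_functional \<phi> \<psi> \<theta> js k (bs ! k) = 0) \<longrightarrow> \<phi> (prod_list bs) = 0) \<and>
        ((\<forall>k<length js. word_functional \<psi> \<psi> \<theta> js k (bs ! k) = 0) \<longrightarrow> \<psi> (prod_list bs) = 0) \<and>
        ((\<forall>k<length js. word_functional \<theta> \<psi> \<theta> js k (bs ! k) = 0) \<longrightarrow> \<theta> (prod_list bs) = 0))"

definition alpha_free ::
  "(complex \<Rightarrow> 'a::ring_1 \<Rightarrow> 'a) \<Rightarrow> ('a \<Rightarrow> complex) \<Rightarrow> ('a \<Rightarrow> complex) \<Rightarrow> ('a \<Rightarrow> complex)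
    \<Rightarrow> 'i::linorder set \<Rightarrow> ('i \<Rightarrow> 'a) \<Rightarrow> bool" where
  "alpha_free sc \<phi> \<psi> \<theta> I a \<longleftrightarrow>
     alpha_free_subalgebras sc \<phi> \<psi> \<theta> I (\<lambda>i. generated_subalgebra sc (a i))"

section \<open>Ordered noncrossing partitions\<close>

definition ordered_set_partition :: "nat \<Rightarrow> nat set list \<Rightarrow> bool" where
  "ordered_set_partition n \<pi> \<longleftrightarrow> distinct \<pi> \<and> partition_on {1..n} (set \<pi>)"

definition noncrossing :: "nat set set \<Rightarrow> bool" where
  "noncrossing \<P> \<longleftrightarrow>
     \<not> (\<exists>P\<in>\<P>. \<exists>Q\<in>\<P>. P \<noteq> Q \<and>
          (\<exists>a b c d. a < b \<and> b < c \<and> c < d \<and> a \<in> P \<and> c \<in> P \<and> b \<in> Q \<and> d \<in> Q))"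

definition ONC :: "nat \<Rightarrow> nat set list set" where
  "ONC n = {\<pi>. ordered_set_partition n \<pi> \<and> noncrossing (set \<pi>)}"

definition ONC_pair :: "nat \<Rightarrow> nat set list set" where
  "ONC_pair n = {\<pi> \<in> ONC n. \<forall>P\<in>set \<pi>. card P = 2}"

lemma finite_ONC: "finite (ONC n)"
proof (rule finite_subset)
  show "ONC n \<subseteq> {\<pi>. set \<pi> \<subseteq> Pow {1..n} \<and> distinct \<pi>}"
    by (auto simp: ONC_def ordered_set_partition_def partition_on_def)
  show "finite {\<pi>. set \<pi> \<subseteq> Pow {1..n} \<and> distinct \<pi>}"
    by (rule finite_subset_distinct) auto
qed

lemma finite_ONC_pair: "finite (ONC_pair n)"
  using finite_ONC[of n] by (simp add: ONC_pair_def)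

definition precedes :: "'b list \<Rightarrow> 'b \<Rightarrow> 'b \<Rightarrow> bool" where
  "precedes \<pi> P Q \<longleftrightarrow> (\<exists>i j. i < j \<and> j < length \<pi> \<and> \<pi> ! i = P \<and> \<pi> ! j = Q)"

definition covers :: "nat set \<Rightarrow> nat set \<Rightarrow> bool" where
  "covers P' P \<longleftrightarrow> (\<exists>i\<in>P'. \<exists>j\<in>P'. \<forall>k\<in>P. i < k \<and> k < j)"

definition inner_blocks :: "nat set list \<Rightarrow> nat set set" where
  "inner_blocks \<pi> = {P \<in> set \<pi>. \<exists>P'\<in>set \<pi>. covers P' P}"

definition outer_blocks :: "nat set list \<Rightarrow> nat set set" where
  "outer_blocks \<pi> = set \<pi> - inner_blocks \<pi>"

definition is_nearest_cover :: "nat set list \<Rightarrow> nat set \<Rightarrow> nat set \<Rightarrow> bool" where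
  "is_nearest_cover \<pi> P C \<longleftrightarrow>
     C \<in> set \<pi> \<and> covers C P \<and> \<not> (\<exists>P'\<in>set \<pi>. covers P' P \<and> covers C P')"

text \<open>
  In a noncrossing partition, any two blocks covering a given block are comparable under \<open>covers\<close>,
  so an inner block has exactly one nearest cover. Elsewhere \<open>nearest_cover\<close> is unspecified.
\<close>

definition nearest_cover :: "nat set list \<Rightarrow> nat set \<Rightarrow> nat set" where
  "nearest_cover \<pi> P = (THE C. is_nearest_cover \<pi> P C)"

definition B_blocks :: "nat set list \<Rightarrow> nat set set" where
  "B_blocks \<pi> = {P \<in> inner_blocks \<pi>. precedes \<pi> (nearest_cover \<pi> P) P}"

definition C_blocks :: "nat set list \<Rightarrow> nat set set" where
  "C_blocks \<pi> = {P \<in> inner_blocks \<pi>. precedes \<pi> P (nearest_cover \<pi> P)}"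

section \<open>The limit distributions\<close>

definition limit_moment :: "complex \<Rightarrow> complex \<Rightarrow> complex \<Rightarrow> nat \<Rightarrow> complex" where
  "limit_moment u v w n =
     (if n = 0 then 1
      else if odd n then 0
      else (\<Sum>\<pi>\<in>ONC_pair n. 1 / fact (n div 2) *
              u ^ card (outer_blocks \<pi>) * v ^ card (B_blocks \<pi>) * w ^ card (C_blocks \<pi>)))"

definition limit_lambda :: "complex \<Rightarrow> complex \<Rightarrow> complex \<Rightarrow> functional" where
  "limit_lambda u v w = functional_of_moments (limit_moment u v w)"

definition limit_mu :: "complex \<Rightarrow> complex \<Rightarrow> functional" where
  "limit_mu v w = limit_lambda v v w"

definition limit_nu :: "complex \<Rightarrow> complex \<Rightarrow> functional" where
  "limit_nu v w = limit_lambda w v w"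

lemma is_distribution_limit_lambda: "is_distribution (limit_lambda u v w)"
  unfolding limit_lambda_def
  by (rule is_distribution_functional_of_moments) (simp add: limit_moment_def)

lemma is_distribution_distr:
  assumes "f 1 = 1"
  shows "is_distribution (distr f a)"
  unfolding distr_def
  by (rule is_distribution_functional_of_moments) (simp add: assms)

end

theory Submission imports Defs begin

text \<open>
  A word in the \<open>a i\<close> is read from left to right onto a stack of letters, each centred with respect
  to \<open>\<psi>\<close> or \<open>\<theta>\<close> according to whether its index lies above or below the index beneath it (the bottom
  letter with respect to the given functional \<open>\<chi>\<close>). Since every interior letter of an alternating word
  is a peak, a bottom or unconstrained, \<open>\<alpha>\<close>-freeness makes \<open>\<chi>\<close> vanish on every nonempty such stack.
  Pushing a letter splits off its mean as a scalar; a letter with the index of the top is merged into it.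

  An index occurring only once never leaves the stack, so its word has value \<open>0\<close>. If every index
  occurs twice, a crossing likewise leaves a letter stuck, while in the noncrossing case a block is
  closed when the top of the remaining stack is its nearest cover, and it contributes \<open>u\<close>, \<open>v\<close> or \<open>w\<close>.
  The values of words of fixed length are bounded, and words with fewer values than a pairing
  are negligible in number. A noncrossing pair word over \<open>{1..n}\<close> is the same as an ordered
  noncrossing pair partition together with its set of \<open>p\<close> values, whence the factor
  \<open>(n choose p) / n ^ p\<close>, which tends to \<open>1 / p!\<close>.
\<close>

section \<open>Reduction of words\<close>

lemma unital_functional_simps:
  assumes "unital_functional sc f"
  shows unital_functional_add: "f (x + y) = f x + f y"
    and unital_functional_diff: "f (x - y) = f x - f y"
    and unital_functional_scale: "f (sc c x) = c * f x"
    and unital_functional_sum: "f (\<Sum>i\<in>S. g i) = (\<Sum>i\<in>S. f (g i))"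
    and unital_functional_one: "f 1 = 1"
proof -
  interpret f: Vector_Spaces.linear sc "(*)" f
    using assms by (simp add: unital_functional_def)
  show "f (x + y) = f x + f y" "f (x - y) = f x - f y" "f (sc c x) = c * f x"
    "f (\<Sum>i\<in>S. g i) = (\<Sum>i\<in>S. f (g i))" "f 1 = 1"
    using assms by (simp_all add: f.add f.diff f.scale f.sum unital_functional_def)
qed

section \<open>Subalgebras generated by one element\<close>

context unital_complex_algebra
begin

lemma unital_subalgebra_generated: "unital_subalgebra sc (generated_subalgebra sc x)"
  unfolding unital_subalgebra_def generated_subalgebra_def
  by (auto intro!: subspace_Inter)

lemma generator_in_generated: "x \<in> generated_subalgebra sc x"
  by (auto simp: generated_subalgebra_def)

lemma generated_mult:
  "y \<in> generated_subalgebra sc x \<Longrightarrow> z \<in> generated_subalgebra sc x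
    \<Longrightarrow> y * z \<in> generated_subalgebra sc x"
  using unital_subalgebra_generated by (auto simp: unital_subalgebra_def)

lemma generated_diff_const:
  "y \<in> generated_subalgebra sc x \<Longrightarrow> y - sc c 1 \<in> generated_subalgebra sc x"
  using unital_subalgebra_generated[of x] subspace_diff subspace_scale
  by (auto simp: unital_subalgebra_def)

end

locale centred_alpha_free = three_prob_space sc \<phi> \<psi> \<theta>
  for sc :: "complex \<Rightarrow> 'a::ring_1 \<Rightarrow> 'a" and \<phi> \<psi> \<theta> :: "'a \<Rightarrow> complex" +
  fixes I :: "'i::linorder set" and a :: "'i \<Rightarrow> 'a"
  assumes free: "alpha_free sc \<phi> \<psi> \<theta> I a"
    and centred: "i \<in> I \<Longrightarrow> \<phi> (a i) = 0 \<and> \<psi> (a i) = 0 \<and> \<theta> (a i) = 0"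
begin

abbreviation alg :: "'i \<Rightarrow> 'a set" where
  "alg i \<equiv> generated_subalgebra sc (a i)"

lemma unital: "\<chi> \<in> {\<phi>, \<psi>, \<theta>} \<Longrightarrow> unital_functional sc \<chi>"
  using unital_phi unital_psi unital_theta by auto

text \<open>The families \<alpha>, \<beta>, \<gamma> differ only at the first letter, so one
  statement with \<chi> there combines the three clauses of freeness, and all later arguments treat
  the three functionals at once.\<close>

lemma alpha_free_vanish:
  assumes "\<chi> \<in> {\<phi>, \<psi>, \<theta>}" "js \<in> alternating I" "length bs = length js"
    and "\<And>k. k < length js \<Longrightarrow> bs ! k \<in> alg (js ! k)"
    and "\<And>k. k < length js \<Longrightarrow> word_functional \<chi> \<psi> \<theta> js k (bs ! k) = 0"
  shows "\<chi> (prod_list bs) = 0"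
  using free assms unfolding alpha_free_def alpha_free_subalgebras_def by blast

text \<open>
  A word is stored as a stack, its last letter on top; \<open>top_functional \<chi> is i\<close> is the functional
  in whose kernel a letter of index \<open>i\<close> is centred when it is pushed on a stack with indices \<open>is\<close>.
\<close>

fun top_functional :: "('a \<Rightarrow> complex) \<Rightarrow> 'i list \<Rightarrow> 'i \<Rightarrow> 'a \<Rightarrow> complex" where
  "top_functional \<chi> [] i = \<chi>"
| "top_functional \<chi> (j # is) i = (if j < i then \<psi> else \<theta>)"

text \<open>A letter above its left neighbour can only become a peak, one below it only a bottom.
  The letter to its right is still unread when it is pushed, so it is centred in advance for the one
  role it can take.\<close>

fun reduced :: "('a \<Rightarrow> complex) \<Rightarrow> ('i \<times> 'a) list \<Rightarrow> bool" where
  "reduced \<chi> [] \<longleftrightarrow> True"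
| "reduced \<chi> ((i, b) # p) \<longleftrightarrow> i \<in> I \<and> b \<in> alg i \<and> (p = [] \<or> fst (hd p) \<noteq> i) \<and>
     top_functional \<chi> (map fst p) i b = 0 \<and> reduced \<chi> p"

definition stack_prod :: "('i \<times> 'a) list \<Rightarrow> 'a" where
  "stack_prod p = prod_list (map snd (rev p))"

lemma stack_prod_simps [simp]:
  "stack_prod [] = 1" "stack_prod ((i, b) # p) = stack_prod p * b"
  by (simp_all add: stack_prod_def)

lemma top_functional_cases:
  "\<chi> \<in> {\<phi>, \<psi>, \<theta>} \<Longrightarrow> top_functional \<chi> is i \<in> {\<phi>, \<psi>, \<theta>}"
  by (cases "is") auto

lemma top_functional_generator:
  "\<chi> \<in> {\<phi>, \<psi>, \<theta>} \<Longrightarrow> i \<in> I \<Longrightarrow> top_functional \<chi> is i (a i) = 0"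
  using top_functional_cases[of \<chi> "is" i] centred[of i] by auto

lemma reduced_drop: "reduced \<chi> p \<Longrightarrow> reduced \<chi> (drop n p)"
proof (induction n arbitrary: p)
  case (Suc n)
  then show ?case by (cases p) auto
qed simp

text \<open>Entry \<open>Suc k\<close> lies beneath entry \<open>k\<close>, so it is the left
  neighbour in the product; the last entry is the first factor.\<close>

lemma reduced_nth:
  assumes "reduced \<chi> p" "k < length p"
  shows "fst (p ! k) \<in> I" "snd (p ! k) \<in> alg (fst (p ! k))"
    and "Suc k < length p \<Longrightarrow> fst (p ! Suc k) \<noteq> fst (p ! k)"
    and "Suc k < length p \<Longrightarrow>
      (if fst (p ! Suc k) < fst (p ! k) then \<psi> else \<theta>) (snd (p ! k)) = 0"
    and "Suc k = length p \<Longrightarrow> \<chi> (snd (p ! k)) = 0"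
proof -
  obtain i b where ib: "p ! k = (i, b)" by fastforce
  have r: "reduced \<chi> ((i, b) # drop (Suc k) p)"
    using reduced_drop[OF assms(1), of k] Cons_nth_drop_Suc[OF assms(2)] ib by simp
  then show "fst (p ! k) \<in> I" "snd (p ! k) \<in> alg (fst (p ! k))"
    "Suc k = length p \<Longrightarrow> \<chi> (snd (p ! k)) = 0" by (auto simp: ib)
  show "fst (p ! Suc k) \<noteq> fst (p ! k)"
    "(if fst (p ! Suc k) < fst (p ! k) then \<psi> else \<theta>) (snd (p ! k)) = 0"
    if l: "Suc k < length p"
    using r Cons_nth_drop_Suc[OF l, symmetric] by (auto simp: ib)
qed

text \<open>Read from the bottom, the indices of the stack alternate. A peak exceeds its left
  neighbour and so was centred for \<psi>, a bottom likewise for \<theta>, the first letter for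
  \<chi>; at all other positions \<open>word_functional\<close> is the zero functional.\<close>

lemma reduced_vanish:
  assumes chi: "\<chi> \<in> {\<phi>, \<psi>, \<theta>}" and red: "reduced \<chi> p" and "p \<noteq> []"
  shows "\<chi> (stack_prod p) = 0"
proof -
  define js where "js = map fst (rev p)"
  define n where "n = length p"
  have js: "js ! k = fst (p ! (n - Suc k))" if "k < n" for k
    using that by (simp add: js_def n_def rev_nth)
  have adj: "distinct_adj js"
    unfolding distinct_adj_conv_nth
  proof (intro allI impI)
    fix k assume "Suc k < length js"
    then have "Suc k < n" by (simp add: js_def n_def)
    then show "js ! k \<noteq> js ! Suc k"
      using reduced_nth(3)[OF red, of "n - Suc (Suc k)"] by (simp add: js n_def Suc_diff_Suc)
  qed
  have I: "set js \<subseteq> I"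
    using reduced_nth(1)[OF red] by (fastforce simp: js_def in_set_conv_nth)
  have wf: "word_functional \<chi> \<psi> \<theta> js k (map snd (rev p) ! k) = 0" if k: "k < n" for k
  proof (cases k)
    case 0
    have "Suc (n - 1) = length p" using k by (simp add: n_def)
    then show ?thesis using 0 k reduced_nth(5)[OF red, of "n - 1"]
      by (simp add: word_functional_def n_def rev_nth)
  next
    case (Suc m)
    \<comment> \<open>Position \<open>k\<close> of the word is entry \<open>n - Suc k\<close> of the
      stack; its left neighbour is entry \<open>n - k\<close>.\<close>
    have eq: "Suc (n - Suc k) = n - k" using k by (simp add: Suc_diff_Suc)
    have "(if fst (p ! (n - k)) < fst (p ! (n - Suc k)) then \<psi> else \<theta>) (snd (p ! (n - Suc k))) = 0"
      using reduced_nth(4)[OF red, of "n - Suc k"] Suc k eq by (simp add: n_def)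
    moreover have "js ! (k - 1) = fst (p ! (n - k))" "js ! k = fst (p ! (n - Suc k))"
      using k Suc by (simp_all add: js)
    ultimately show ?thesis using k Suc
      by (auto simp: word_functional_def Peak_def Bot_def n_def rev_nth split: if_splits)
  qed
  have "\<chi> (prod_list (map snd (rev p))) = 0"
  proof (rule alpha_free_vanish[OF chi, of js])
    show "js \<in> alternating I" using adj I \<open>p \<noteq> []\<close> by (simp add: alternating_def js_def)
    show "length (map snd (rev p)) = length js" by (simp add: js_def)
    show "map snd (rev p) ! k \<in> alg (js ! k)" if "k < length js" for k
      using that reduced_nth(2)[OF red, of "n - Suc k"] js[of k]
      by (simp add: js_def n_def rev_nth)
    show "word_functional \<chi> \<psi> \<theta> js k (map snd (rev p) ! k) = 0" if "k < length js" for k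
      using that wf[of k] by (simp add: js_def n_def)
  qed
  then show ?thesis by (simp add: stack_prod_def)
qed

text \<open>Splits \<open>b\<close> into its mean and a centred part, the mean being taken for the
  functional that keeps the stack reduced. The factor \<open>x\<close> is the unread rest of the
  word; the scalar term continues on the old stack.\<close>

lemma push:
  assumes chi: "\<chi> \<in> {\<phi>, \<psi>, \<theta>}" and red: "reduced \<chi> p"
    and b: "i \<in> I" "b \<in> alg i" and top: "p = [] \<or> fst (hd p) \<noteq> i"
  defines "c \<equiv> top_functional \<chi> (map fst p) i b"
  shows "reduced \<chi> ((i, b - sc c 1) # p)"
    and "\<chi> (stack_prod p * b * x) =
      \<chi> (stack_prod ((i, b - sc c 1) # p) * x) + c * \<chi> (stack_prod p * x)"
proof -
  have "unital_functional sc (top_functional \<chi> (map fst p) i)"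
    using top_functional_cases[OF chi] unital by blast
  then show "reduced \<chi> ((i, b - sc c 1) # p)"
    using red b top
    by (auto simp: generated_diff_const unital_functional_diff unital_functional_scale
        unital_functional_one c_def)
  have "stack_prod p * b * x = stack_prod ((i, b - sc c 1) # p) * x + sc c (stack_prod p * x)"
    by (simp add: algebra_simps scale_mult_left scale_mult_right)
  then show "\<chi> (stack_prod p * b * x) =
      \<chi> (stack_prod ((i, b - sc c 1) # p) * x) + c * \<chi> (stack_prod p * x)"
    using unital[OF chi] by (simp only: unital_functional_add unital_functional_scale)
qed

text \<open>A letter with the index of the top is multiplied into it, and the product is pushed
  again on \<open>p'\<close>. Adjacent indices of a reduced stack differ, so this second push is
  legitimate.\<close>

lemma absorb_cases:
  assumes "reduced \<chi> p" "j \<in> I"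
  obtains (new) "p = [] \<or> fst (hd p) \<noteq> j"
  | (merge) b p' where "p = (j, b) # p'" "reduced \<chi> p'" "b * a j \<in> alg j"
      "p' = [] \<or> fst (hd p') \<noteq> j"
proof (cases p)
  case (Cons q p')
  then show ?thesis
    using assms new merge[of "snd q" p']
    by (cases q; cases "fst q = j") (auto simp: generated_mult generator_in_generated)
qed (use new in blast)

text \<open>Only the top letter can be removed, and only on reading a letter of its own index. Since
  \<open>i\<close> does not occur again, it survives in both terms of every \<open>push\<close>, and
  the reading ends in reduced nonempty stacks.\<close>

lemma stuck_vanish:
  assumes chi: "\<chi> \<in> {\<phi>, \<psi>, \<theta>}"
  shows "reduced \<chi> p \<Longrightarrow> i \<in> fst ` set p \<Longrightarrow> i \<notin> set js \<Longrightarrow> set js \<subseteq> I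
    \<Longrightarrow> \<chi> (stack_prod p * prod_list (map a js)) = 0"
proof (induction js arbitrary: p)
  case Nil
  then have "p \<noteq> []" by auto
  then show ?case using reduced_vanish[OF chi Nil.prems(1)] by simp
next
  case (Cons j js)
  then have j: "j \<in> I" "j \<noteq> i" by auto
  show ?case
    using Cons.prems(1) j(1)
  proof (cases rule: absorb_cases)
    case new
    note p = push[OF chi Cons.prems(1) j(1) generator_in_generated new]
    show ?thesis
      using Cons.IH[OF p(1)] Cons.IH[OF Cons.prems(1)] Cons.prems
      by (simp add: p(2) flip: mult.assoc)
  next
    case (merge b p')
    note p = push[OF chi merge(2) j(1) merge(3,4)]
    have "i \<in> fst ` set p'" using Cons.prems(2) merge(1) j by auto
    then show ?thesis
      using Cons.IH[OF p(1)] Cons.IH[OF merge(2)] Cons.prems p(2)[of "prod_list (map a js)"]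
      by (simp add: merge(1) mult.assoc)
  qed
qed

text \<open>Before the sole \<open>i\<close> is read, no stack in the expansion contains
  \<open>i\<close>. When it is pushed, its scalar term is zero because the generator is centred, and
  the remaining term is stuck.\<close>

lemma singleton_vanish:
  assumes chi: "\<chi> \<in> {\<phi>, \<psi>, \<theta>}"
  shows "reduced \<chi> p \<Longrightarrow> i \<notin> fst ` set p \<Longrightarrow> count_list js i = 1 \<Longrightarrow> set js \<subseteq> I
    \<Longrightarrow> \<chi> (stack_prod p * prod_list (map a js)) = 0"
proof (induction js arbitrary: p)
  case (Cons j js)
  then have j: "j \<in> I" by auto
  show ?case
  proof (cases "j = i")
    case True
    have new: "p = [] \<or> fst (hd p) \<noteq> j"
      using Cons.prems(2) True by (cases p) auto
    note p = push[OF chi Cons.prems(1) j generator_in_generated new]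
    have "i \<notin> set js" using Cons.prems(3) True by (simp add: count_list_0_iff)
    then show ?thesis
      using stuck_vanish[OF chi p(1), of i js] True Cons.prems(4)
        p(2)[of "prod_list (map a js)"]
      by (simp add: top_functional_generator[OF chi] mult.assoc)
  next
    case False
    show ?thesis
      using Cons.prems(1) j
    proof (cases rule: absorb_cases)
      case new
      note p = push[OF chi Cons.prems(1) j generator_in_generated new]
      show ?thesis
        using Cons.IH[OF p(1)] Cons.IH[OF Cons.prems(1)] Cons.prems False
        by (simp add: p(2) flip: mult.assoc)
    next
      case (merge b p')
      note p = push[OF chi merge(2) j merge(3,4)]
      have "i \<notin> fst ` set p'" using Cons.prems(2) merge(1) by auto
      then show ?thesis
        using Cons.IH[OF p(1)] Cons.IH[OF merge(2)] Cons.prems False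
          p(2)[of "prod_list (map a js)"]
        by (simp add: merge(1) mult.assoc)
    qed
  qed
qed simp

corollary singleton_word_vanish:
  assumes "\<chi> \<in> {\<phi>, \<psi>, \<theta>}" "count_list js i = 1" "set js \<subseteq> I"
  shows "\<chi> (prod_list (map a js)) = 0"
  using singleton_vanish[OF assms(1), of "[]" i js] assms(2,3) by simp

end

section \<open>Uniform bounds on moments of words\<close>

context unital_complex_algebra
begin

text \<open>Letters of one index are kept as polynomials in its generator, which separates the form
  of a letter from its index.\<close>

definition poly_eval :: "'a \<Rightarrow> complex poly \<Rightarrow> 'a" where
  "poly_eval x q = (\<Sum>i\<le>degree q. sc (coeff q i) (x ^ i))"

lemma poly_eval_altdef:
  assumes "degree q \<le> n"
  shows "poly_eval x q = (\<Sum>i\<le>n. sc (coeff q i) (x ^ i))"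
  unfolding poly_eval_def
  by (rule sum.mono_neutral_left) (use assms in \<open>auto simp: coeff_eq_0\<close>)

lemma poly_eval_1 [simp]: "poly_eval x 1 = 1"
  by (simp add: poly_eval_def)

lemma poly_eval_pCons_0: "poly_eval x (pCons 0 q) = poly_eval x q * x"
proof -
  have "poly_eval x (pCons 0 q) = (\<Sum>i\<le>Suc (degree q). sc (coeff (pCons 0 q) i) (x ^ i))"
    by (rule poly_eval_altdef) (simp add: degree_pCons_le)
  also have "\<dots> = (\<Sum>i\<le>degree q. sc (coeff q i) (x ^ i * x))"
    by (subst sum.atMost_Suc_shift) (simp add: power_commutes)
  also have "\<dots> = poly_eval x q * x"
    by (simp add: poly_eval_def sum_distrib_right scale_mult_left)
  finally show ?thesis .
qed

lemma poly_eval_diff_const: "poly_eval x (q - [:c:]) = poly_eval x q - sc c 1"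
proof -
  have "degree (q - [:c:]) \<le> degree q" by (simp add: degree_diff_le)
  then have "poly_eval x (q - [:c:]) = (\<Sum>i\<le>degree q. sc (coeff (q - [:c:]) i) (x ^ i))"
    by (rule poly_eval_altdef)
  also have "\<dots> = (\<Sum>i\<le>degree q. sc (coeff q i) (x ^ i) - (if i = 0 then sc c 1 else 0))"
    by (intro sum.cong) (auto simp: scale_left_diff_distrib coeff_pCons split: nat.splits)
  also have "\<dots> = poly_eval x q - sc c 1"
    by (simp add: poly_eval_def sum_subtractf)
  finally show ?thesis .
qed

text \<open>The mean of a letter depends on its index only through the distribution of the
  generator, hence not at all for identically distributed elements.\<close>

lemma unital_functional_poly_eval:
  "unital_functional sc f \<Longrightarrow> f (poly_eval x q) = distr f x q"
  by (simp add: poly_eval_def distr_def functional_of_moments_def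
      unital_functional_sum unital_functional_scale)

end

context centred_alpha_free
begin

definition poly_stack :: "('i \<times> complex poly) list \<Rightarrow> ('i \<times> 'a) list" where
  "poly_stack = map (\<lambda>(i, q). (i, poly_eval (a i) q))"

lemma poly_stack_simps [simp]:
  "poly_stack [] = []" "poly_stack ((i, q) # p) = (i, poly_eval (a i) q) # poly_stack p"
  by (simp_all add: poly_stack_def)

text \<open>
  The reduction replaces the letter polynomials \<open>q\<close> only by \<open>x q\<close> and \<open>q - c\<close>, with \<open>c\<close> from
  finitely many moments, so the finitely many polynomials reached do not depend on the indices.
\<close>

lemma reduced_word_bounded:
  assumes chi: "\<chi> \<in> {\<phi>, \<psi>, \<theta>}" and ident: "identically_distributed \<phi> \<psi> \<theta> I a"
    and "finite Q"
  shows "\<exists>B. \<forall>p js. snd ` set p \<subseteq> Q \<and> reduced \<chi> (poly_stack p) \<and> length js = n \<and> set js \<subseteq> I \<longrightarrow>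
    cmod (\<chi> (stack_prod (poly_stack p) * prod_list (map a js))) \<le> B"
  using \<open>finite Q\<close>
proof (induction n arbitrary: Q)
  case 0
  \<comment> \<open>With nothing left to read, the value is \<open>0\<close>, or \<open>1\<close> on
    the empty stack.\<close>
  have "cmod (\<chi> (stack_prod (poly_stack p))) \<le> 1" if "reduced \<chi> (poly_stack p)" for p
    using reduced_vanish[OF chi that] unital_functional_one[OF unital[OF chi]]
    by (cases "poly_stack p = []") auto
  then show ?case by (intro exI[of _ 1]) auto
next
  case (Suc n)
  \<comment> \<open>\<open>Q1\<close> holds the letters about to be pushed: a generator
    (\<open>pCons 0 1\<close>) or a top letter multiplied by one. \<open>K\<close> holds their
    possible means, \<open>Q2\<close> the letters possible after the push. Identical distribution
    leaves at most three functionals in \<open>D\<close>, so \<open>K\<close> is finite.\<close>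
  define D where "D = {distr \<omega> (a i) |\<omega> i. \<omega> \<in> {\<phi>, \<psi>, \<theta>} \<and> i \<in> I}"
  define Q1 where "Q1 = pCons 0 ` insert 1 Q"
  define K where "K = (\<lambda>(L, q). L q) ` (D \<times> Q1)"
  define Q2 where "Q2 = Q \<union> (\<lambda>(q, c). q - [:c:]) ` (Q1 \<times> K)"
  have "finite D"
  proof (cases "I = {}")
    case False
    then obtain i where "i \<in> I" by blast
    have "distr \<omega> (a j) = distr \<omega> (a i)" if "\<omega> \<in> {\<phi>, \<psi>, \<theta>}" "j \<in> I" for \<omega> j
    proof -
      have "distr3 \<phi> \<psi> \<theta> (a j) = distr3 \<phi> \<psi> \<theta> (a i)"
        using ident that(2) \<open>i \<in> I\<close> unfolding identically_distributed_def by blast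
      then show ?thesis using that(1) by (auto simp: distr3_def)
    qed
    then have "D \<subseteq> (\<lambda>\<omega>. distr \<omega> (a i)) ` {\<phi>, \<psi>, \<theta>}" unfolding D_def by blast
    then show ?thesis by (rule finite_subset) simp
  qed (simp add: D_def)
  then have fin: "finite K" "finite Q2"
    using Suc.prems by (simp_all add: K_def Q1_def Q2_def)
  obtain B where B: "\<And>p js. snd ` set p \<subseteq> Q2 \<Longrightarrow> reduced \<chi> (poly_stack p) \<Longrightarrow> length js = n
      \<Longrightarrow> set js \<subseteq> I \<Longrightarrow> cmod (\<chi> (stack_prod (poly_stack p) * prod_list (map a js))) \<le> B"
    using Suc.IH[OF fin(2)] by blast
  define C where "C = (\<Sum>c\<in>K. cmod c)"
  have C: "cmod c \<le> C" if "c \<in> K" for c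
    unfolding C_def using that fin(1) by (intro member_le_sum) auto
  have "C \<ge> 0" by (simp add: C_def sum_nonneg)
  \<comment> \<open>A new and a merged letter are both a push from \<open>Q1\<close>. Each of the
    two resulting terms falls under the bound \<open>B\<close>, the second one with a coefficient of
    modulus at most \<open>C\<close>.\<close>
  have main: "cmod (\<chi> (stack_prod (poly_stack p) * poly_eval (a j) q * prod_list (map a js)))
      \<le> B + C * B"
    if p: "snd ` set p \<subseteq> Q" "reduced \<chi> (poly_stack p)" and q: "q \<in> Q1" "poly_eval (a j) q \<in> alg j"
      and js: "length js = n" "j \<in> I" "set js \<subseteq> I"
      and top: "poly_stack p = [] \<or> fst (hd (poly_stack p)) \<noteq> j" for p q j js
  proof -
    define c where "c = top_functional \<chi> (map fst (poly_stack p)) j (poly_eval (a j) q)"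
    define \<omega> where "\<omega> = top_functional \<chi> (map fst (poly_stack p)) j"
    have \<omega>: "\<omega> \<in> {\<phi>, \<psi>, \<theta>}" unfolding \<omega>_def by (rule top_functional_cases[OF chi])
    have "c = distr \<omega> (a j) q"
      unfolding c_def \<omega>_def[symmetric] by (rule unital_functional_poly_eval[OF unital[OF \<omega>]])
    moreover have "distr \<omega> (a j) \<in> D" using \<omega> js(2) unfolding D_def by blast
    ultimately have c: "c \<in> K" using q(1) by (force simp: K_def)
    have ps: "(j, poly_eval (a j) q - sc c 1) # poly_stack p = poly_stack ((j, q - [:c:]) # p)"
      by (simp add: poly_eval_diff_const)
    note push = push[OF chi p(2) js(2) q(2) top, folded c_def, unfolded ps]
    let ?x = "prod_list (map a js)"
    have "q - [:c:] \<in> Q2" using q(1) c by (auto simp: Q2_def)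
    then have 1: "cmod (\<chi> (stack_prod (poly_stack ((j, q - [:c:]) # p)) * ?x)) \<le> B"
      using B[of "(j, q - [:c:]) # p" js] push(1) p(1) js by (auto simp: Q2_def)
    have 2: "cmod (\<chi> (stack_prod (poly_stack p) * ?x)) \<le> B"
      using B[of p js] p js by (auto simp: Q2_def)
    have "cmod (\<chi> (stack_prod (poly_stack p) * poly_eval (a j) q * ?x)) \<le>
        cmod (\<chi> (stack_prod (poly_stack ((j, q - [:c:]) # p)) * ?x)) +
        cmod c * cmod (\<chi> (stack_prod (poly_stack p) * ?x))"
      unfolding push(2) by (metis norm_mult norm_triangle_ineq)
    also have "\<dots> \<le> B + C * B"
      using 1 2 C[OF c] \<open>C \<ge> 0\<close> by (intro add_mono mult_mono) auto
    finally show ?thesis .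
  qed
  have "cmod (\<chi> (stack_prod (poly_stack p) * prod_list (map a js))) \<le> B + C * B"
    if p: "snd ` set p \<subseteq> Q" "reduced \<chi> (poly_stack p)" and js: "length js = Suc n" "set js \<subseteq> I"
    for p js
  proof -
    obtain j js' where js': "js = j # js'" "length js' = n" "j \<in> I" "set js' \<subseteq> I"
      using js by (cases js) auto
    show ?thesis
      using p(2) js'(3)
    proof (cases rule: absorb_cases)
      case new
      then show ?thesis
        using main[OF p, of "pCons 0 1" j js'] js' generator_in_generated[of "a j"]
        by (simp add: Q1_def poly_eval_pCons_0 mult.assoc)
    next
      case (merge b p')
      then obtain q p1 where p1: "p = (j, q) # p1" "p' = poly_stack p1" "b = poly_eval (a j) q"
        by (cases p) (auto simp: poly_stack_def)
      then show ?thesis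
        using main[of p1 "pCons 0 q" j js'] merge js' p(1)
        by (simp add: Q1_def poly_eval_pCons_0 mult.assoc)
    qed
  qed
  then show ?case by blast
qed

lemma word_bounded:
  assumes "\<chi> \<in> {\<phi>, \<psi>, \<theta>}" "identically_distributed \<phi> \<psi> \<theta> I a"
  obtains B where "\<And>js. length js = n \<Longrightarrow> set js \<subseteq> I \<Longrightarrow> cmod (\<chi> (prod_list (map a js))) \<le> B"
proof -
  obtain B where B: "\<And>p js. snd ` set p \<subseteq> {} \<Longrightarrow> reduced \<chi> (poly_stack p) \<Longrightarrow> length js = n
      \<Longrightarrow> set js \<subseteq> I \<Longrightarrow> cmod (\<chi> (stack_prod (poly_stack p) * prod_list (map a js))) \<le> B"
    using reduced_word_bounded[OF assms, of "{}" n] by auto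
  show thesis by (rule that) (use B[of "[]"] in simp)
qed

end

section \<open>Pair words\<close>

text \<open>List positions are counted from 0, the points of a partition from 1.\<close>

definition fiber :: "'i list \<Rightarrow> 'i \<Rightarrow> nat set" where
  "fiber js i = Suc ` {x. x < length js \<and> js ! x = i}"

definition pairing :: "'i list \<Rightarrow> bool" where
  "pairing js \<longleftrightarrow> (\<forall>i\<in>set js. count_list js i = 2)"

lemma Suc_in_fiber [simp]: "Suc x \<in> fiber js i \<longleftrightarrow> x < length js \<and> js ! x = i"
  by (auto simp: fiber_def)

lemma card_fiber: "card (fiber js i) = count_list js i"
proof -
  have "count_list js i = card {x. x < length js \<and> js ! x = i}"
    by (simp add: count_list_eq_length_filter length_filter_conv_card eq_commute)
  then show ?thesis by (simp add: fiber_def card_image)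
qed

lemma fiber_nonempty: "i \<in> set js \<Longrightarrow> fiber js i \<noteq> {}"
  by (auto simp: fiber_def in_set_conv_nth)

lemma inj_on_fiber: "inj_on (fiber js) (set js)"
proof (rule inj_onI)
  fix i j assume "i \<in> set js" "fiber js i = fiber js j"
  moreover from this obtain x where "x < length js" "js ! x = i"
    by (auto simp: in_set_conv_nth)
  ultimately show "i = j" by (metis Suc_in_fiber)
qed

lemma pairing_fiber:
  assumes "pairing js" "s < t" "t < length js" "js ! s = js ! t"
  shows "fiber js (js ! t) = {Suc s, Suc t}"
proof -
  have "card (fiber js (js ! t)) = 2"
    using assms by (simp add: card_fiber pairing_def)
  moreover have "{Suc s, Suc t} \<subseteq> fiber js (js ! t)" using assms by auto
  ultimately show ?thesis
    using assms(2) card_subset_eq[of "fiber js (js ! t)" "{Suc s, Suc t}"]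
    by (simp add: card_ge_0_finite)
qed

lemma pairing_two:
  assumes "pairing js" "s < t" "t < length js" "js ! s = js ! t" "x < length js" "js ! x = js ! t"
  shows "x = s \<or> x = t"
  using pairing_fiber[OF assms(1-4)] Suc_in_fiber[of x js "js ! t"] assms(5,6) by auto

lemma pairing_partner:
  assumes "pairing js" "s < length js"
  obtains t where "t < length js" "t \<noteq> s" "js ! t = js ! s"
proof -
  have "card (fiber js (js ! s)) = 2"
    using assms by (simp add: card_fiber pairing_def)
  then obtain y where "y \<in> fiber js (js ! s)" "y \<noteq> Suc s"
    by (metis card_2_iff' )
  then show thesis using that by (auto simp: fiber_def)
qed

section \<open>Positions of unfinished blocks\<close>

lemma in_set_take_iff: "t \<le> length js \<Longrightarrow> x \<in> set (take t js) \<longleftrightarrow> (\<exists>s<t. js ! s = x)"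
  by (auto simp: in_set_conv_nth)

lemma in_set_drop_iff: "x \<in> set (drop t js) \<longleftrightarrow> (\<exists>s\<ge>t. s < length js \<and> js ! s = x)"
proof
  assume "x \<in> set (drop t js)"
  then obtain y where "y < length js - t" "drop t js ! y = x" by (auto simp: in_set_conv_nth)
  then show "\<exists>s\<ge>t. s < length js \<and> js ! s = x" by (intro exI[of _ "t + y"]) auto
next
  assume "\<exists>s\<ge>t. s < length js \<and> js ! s = x"
  then obtain s where "s \<ge> t" "s < length js" "js ! s = x" by blast
  then show "x \<in> set (drop t js)"
    unfolding in_set_conv_nth by (intro exI[of _ "s - t"]) auto
qed

text \<open>The stack just before position \<open>t\<close> is read, given by positions, provided
  that every earlier second occurrence met the top: blocks begun and not yet finished, the latest
  first.\<close>

definition open_positions :: "'i list \<Rightarrow> nat \<Rightarrow> nat list" where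
  "open_positions js t = rev (filter (\<lambda>s. js ! s \<in> set (drop t js)) [0..<t])"

text \<open>A first occurrence passes; a second occurrence must find its partner on top. Failure is
  how a crossing shows while reading from left to right.\<close>

definition closes_top :: "'i list \<Rightarrow> nat \<Rightarrow> bool" where
  "closes_top js t \<longleftrightarrow> (js ! t \<in> set (take t js) \<longrightarrow>
     open_positions js t \<noteq> [] \<and> js ! hd (open_positions js t) = js ! t)"

lemma set_open_positions:
  "s \<in> set (open_positions js t) \<longleftrightarrow> s < t \<and> (\<exists>y\<ge>t. y < length js \<and> js ! y = js ! s)"
  by (auto simp: open_positions_def in_set_drop_iff)

lemma distinct_open_positions: "distinct (open_positions js t)"
  by (simp add: open_positions_def)

lemma hd_open_positions_ge:
  assumes "s \<in> set (open_positions js t)"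
  shows "s \<le> hd (open_positions js t)"
proof -
  have "sorted_wrt (\<ge>) (open_positions js t)"
    unfolding open_positions_def sorted_wrt_rev
    by (rule sorted_wrt_filter) (simp add: sorted_wrt_upt)
  then show ?thesis
    using assms by (cases "open_positions js t") auto
qed

lemma open_positions_0 [simp]: "open_positions js 0 = []"
  by (simp add: open_positions_def)

lemma open_positions_length [simp]: "open_positions js (length js) = []"
  by (simp add: open_positions_def)

text \<open>The partner of a first occurrence is still to come, so \<open>t\<close> becomes open;
  the earlier positions carry different values and keep their status.\<close>

lemma open_positions_new:
  assumes "pairing js" "t < length js" "js ! t \<notin> set (take t js)"
  shows "open_positions js (Suc t) = t # open_positions js t"
proof -
  have new: "js ! s \<noteq> js ! t" if "s < t" for s
    using assms that by (auto simp: in_set_take_iff)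
  obtain y where "y < length js" "y \<noteq> t" "js ! y = js ! t"
    using pairing_partner[OF assms(1,2)] .
  moreover from this have "t < y" using new[of y] by (meson linorder_neqE_nat)
  ultimately have "js ! t \<in> set (drop (Suc t) js)"
    by (auto simp: in_set_drop_iff intro!: exI[of _ y])
  moreover have "filter (\<lambda>s. js ! s \<in> set (drop (Suc t) js)) [0..<t] =
      filter (\<lambda>s. js ! s \<in> set (drop t js)) [0..<t]"
    using new by (intro filter_cong) (auto simp: Cons_nth_drop_Suc[OF assms(2), symmetric])
  ultimately show ?thesis by (simp add: open_positions_def)
qed

text \<open>The pair is the whole block, so its opening position \<open>s\<close> is the only one to
  leave the list.\<close>

lemma open_positions_close:
  assumes pair: "pairing js" and t: "t < length js" "js ! t \<in> set (take t js)"
    and "closes_top js t"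
  obtains s where "s < t" "js ! s = js ! t" "open_positions js t = s # open_positions js (Suc t)"
proof -
  define s where "s = hd (open_positions js t)"
  have s: "open_positions js t \<noteq> []" "js ! s = js ! t"
    using assms by (simp_all add: closes_top_def s_def)
  then have "s < t" using hd_in_set[OF s(1)] set_open_positions s_def by blast
  have two: "x = s \<or> x = t" if "x < length js" "js ! x = js ! t" for x
    using pairing_two[OF pair \<open>s < t\<close> t(1) s(2) that] .
  then have "js ! t \<notin> set (drop (Suc t) js)"
    using \<open>s < t\<close> by (fastforce simp: in_set_drop_iff dest!: two)
  moreover have "js ! x \<in> set (drop (Suc t) js) \<longleftrightarrow> js ! x \<in> set (drop t js) \<and> x \<noteq> s" if "x < t" for x
    using that t two[of x] s(2) \<open>js ! t \<notin> set (drop (Suc t) js)\<close>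
    by (auto simp: Cons_nth_drop_Suc[OF t(1), symmetric])
  then have "filter (\<lambda>x. js ! x \<in> set (drop (Suc t) js)) [0..<t] =
      filter (\<lambda>x. x \<noteq> s) (filter (\<lambda>x. js ! x \<in> set (drop t js)) [0..<t])"
    by (auto simp: filter_filter intro!: filter_cong)
  ultimately have eq: "open_positions js (Suc t) = filter (\<lambda>x. x \<noteq> s) (open_positions js t)"
    by (simp add: open_positions_def rev_filter)
  obtain xs where xs: "open_positions js t = s # xs"
    using s(1) s_def by (cases "open_positions js t") auto
  then have "s \<notin> set xs" using distinct_open_positions[of js t] by simp
  then have "open_positions js (Suc t) = xs" unfolding eq xs
    by (simp add: filter_id_conv) (metis filter_True)
  then show thesis using that \<open>s < t\<close> s(2) xs by blast
qed

lemma noncrossing_fibers: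
  "noncrossing (fiber js ` set js) \<longleftrightarrow>
     \<not> (\<exists>x y z q. x < y \<and> y < z \<and> z < q \<and> q < length js \<and>
         js ! x = js ! z \<and> js ! y = js ! q \<and> js ! x \<noteq> js ! y)" (is "?L \<longleftrightarrow> \<not> ?R")
proof
  assume ?L
  show "\<not> ?R"
  proof
    assume ?R
    then obtain x y z q where *: "x < y" "y < z" "z < q" "q < length js"
      "js ! x = js ! z" "js ! y = js ! q" "js ! x \<noteq> js ! y" by blast
    have "fiber js (js ! x) \<noteq> fiber js (js ! y)"
      using inj_onD[OF inj_on_fiber[of js], of "js ! x" "js ! y"] * by auto
    moreover have "js ! x \<in> set js" "js ! y \<in> set js" using * by auto
    moreover have "Suc x < Suc y" "Suc y < Suc z" "Suc z < Suc q"
      "Suc x \<in> fiber js (js ! x)" "Suc z \<in> fiber js (js ! x)"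
      "Suc y \<in> fiber js (js ! y)" "Suc q \<in> fiber js (js ! y)" using * by auto
    ultimately have "\<exists>P\<in>fiber js ` set js. \<exists>Q\<in>fiber js ` set js. P \<noteq> Q \<and>
      (\<exists>x y z q. x < y \<and> y < z \<and> z < q \<and> x \<in> P \<and> z \<in> P \<and> y \<in> Q \<and> q \<in> Q)"
      by (intro bexI[of _ "fiber js (js ! x)"] bexI[of _ "fiber js (js ! y)"] conjI
          exI[of _ "Suc x"] exI[of _ "Suc y"] exI[of _ "Suc z"] exI[of _ "Suc q"] imageI) assumption+
    with \<open>?L\<close> show False unfolding noncrossing_def by (rule notE)
  qed
next
  assume R: "\<not> ?R"
  show ?L
    unfolding noncrossing_def
  proof (rule notI)
    assume "\<exists>P\<in>fiber js ` set js. \<exists>Q\<in>fiber js ` set js. P \<noteq> Q \<and>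
      (\<exists>x y z q. x < y \<and> y < z \<and> z < q \<and> x \<in> P \<and> z \<in> P \<and> y \<in> Q \<and> q \<in> Q)"
    then obtain i j x y z q where *: "fiber js i \<noteq> fiber js j" "x < y" "y < z" "z < q"
      "x \<in> fiber js i" "z \<in> fiber js i" "y \<in> fiber js j" "q \<in> fiber js j" by blast
    obtain x' y' z' q' where xs: "x = Suc x'" "y = Suc y'" "z = Suc z'" "q = Suc q'"
      using *(5-8) unfolding fiber_def by blast
    have "i \<noteq> j" using *(1) by blast
    then have "x' < y'" "y' < z'" "z' < q'" "q' < length js" "js ! x' = js ! z'"
      "js ! y' = js ! q'" "js ! x' \<noteq> js ! y'"
      using *(2-8) by (simp_all add: xs)
    then have ?R by (intro exI conjI)
    with R show False by (rule notE)
  qed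
qed

lemma noncrossing_fibersD:
  assumes "noncrossing (fiber js ` set js)" "x < y" "y < z" "z < q" "q < length js"
    and "js ! x = js ! z" "js ! y = js ! q"
  shows "js ! x = js ! y"
proof (rule ccontr)
  assume "js ! x \<noteq> js ! y"
  with assms(2-) have "\<exists>x y z q. x < y \<and> y < z \<and> z < q \<and> q < length js \<and>
      js ! x = js ! z \<and> js ! y = js ! q \<and> js ! x \<noteq> js ! y"
    by (intro exI conjI)
  with assms(1) show False unfolding noncrossing_fibers by (rule notE)
qed

text \<open>If the second occurrence at \<open>t\<close> of the value at \<open>s\<close> finds
  \<open>m\<close> on top instead, the later partner \<open>y\<close> of \<open>m\<close> gives the
  crossing \<open>s < m < t < y\<close>. Conversely, in a crossing \<open>x < y < z < q\<close> the
  position \<open>y\<close> is still open and above \<open>x\<close> when \<open>z\<close> is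
  read.\<close>

lemma noncrossing_iff_closes_top:
  assumes pair: "pairing js"
  shows "noncrossing (fiber js ` set js) \<longleftrightarrow> (\<forall>t<length js. closes_top js t)"
proof (intro iffI allI impI)
  fix t assume nc: "noncrossing (fiber js ` set js)" and t: "t < length js"
  show "closes_top js t"
  proof (rule ccontr)
    assume bad: "\<not> closes_top js t"
    then obtain s where s: "s < t" "js ! s = js ! t"
      using t by (auto simp: closes_top_def in_set_take_iff)
    then have "s \<in> set (open_positions js t)"
      using t by (auto simp: set_open_positions intro!: exI[of _ t])
    define m where "m = hd (open_positions js t)"
    have "open_positions js t \<noteq> []" using \<open>s \<in> _\<close> by auto
    then have m: "m \<in> set (open_positions js t)" "s \<le> m" "js ! m \<noteq> js ! t"
      using hd_open_positions_ge[OF \<open>s \<in> _\<close>] bad by (simp_all add: m_def closes_top_def)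
    then obtain y where y: "m < t" "t \<le> y" "y < length js" "js ! y = js ! m"
      by (auto simp: set_open_positions)
    have "t \<noteq> y" "s \<noteq> m" using m s y by auto
    then show False
      using noncrossing_fibersD[OF nc, of s m t y] y s m by simp
  qed
next
  assume good: "\<forall>t<length js. closes_top js t"
  show "noncrossing (fiber js ` set js)"
    unfolding noncrossing_fibers
  proof clarify
    fix x y z q
    assume *: "x < y" "y < z" "z < q" "q < length js" "js ! x = js ! z" "js ! y = js ! q"
      "js ! x \<noteq> js ! y"
    have "js ! z \<in> set (take z js)" using * by (auto simp: in_set_take_iff intro!: exI[of _ x])
    then have "open_positions js z \<noteq> []" and h: "js ! hd (open_positions js z) = js ! z"
      using good * by (auto simp: closes_top_def)
    then have hz: "hd (open_positions js z) < z"
      using hd_in_set[of "open_positions js z"] by (auto simp: set_open_positions)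
    then have "hd (open_positions js z) = x"
      using pairing_two[OF pair, of x z "hd (open_positions js z)"] * h by auto
    moreover have "y \<in> set (open_positions js z)"
      using * by (auto simp: set_open_positions intro!: exI[of _ q])
    ultimately show False using hd_open_positions_ge[of y js z] * by auto
  qed
qed

section \<open>Weights of the blocks\<close>

definition level_weight :: "complex \<Rightarrow> complex \<Rightarrow> complex \<Rightarrow> 'i::linorder list \<Rightarrow> 'i \<Rightarrow> complex" where
  "level_weight u v w is i = (case is of [] \<Rightarrow> u | j # _ \<Rightarrow> if j < i then v else w)"

text \<open>A block is charged when its second letter is read. In a noncrossing pairing the
  positions open right after \<open>t\<close> lie beneath the block in the stack; the head belongs
  to the nearest cover, and an empty list means an outer block.\<close>

definition step_weight :: "complex \<Rightarrow> complex \<Rightarrow> complex \<Rightarrow> 'i::linorder list \<Rightarrow> nat \<Rightarrow> complex" where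
  "step_weight u v w js t =
     (if js ! t \<in> set (take t js)
      then level_weight u v w (map ((!) js) (open_positions js (Suc t))) (js ! t) else 1)"

text \<open>The kernel partition of the word with blocks ordered by their values, so that
  \<open>precedes\<close> becomes comparison of indices.\<close>

definition fibers :: "'i::linorder list \<Rightarrow> nat set list" where
  "fibers js = map (fiber js) (sorted_list_of_set (set js))"

lemma set_fibers [simp]: "set (fibers js) = fiber js ` set js"
  by (simp add: fibers_def)

lemma precedes_fibers:
  assumes "i \<in> set js" "j \<in> set js"
  shows "precedes (fibers js) (fiber js i) (fiber js j) \<longleftrightarrow> i < j"
proof -
  define l where "l = sorted_list_of_set (set js)"
  have l: "sorted_wrt (<) l" "set l = set js"
    by (simp_all add: l_def)
  have inj: "fiber js x = fiber js y \<longleftrightarrow> x = y" if "x \<in> set js" "y \<in> set js" for x y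
    using inj_on_eq_iff[OF inj_on_fiber[of js]] that by simp
  have mem: "l ! x \<in> set js" if "x < length l" for x
    using nth_mem[OF that] by (simp add: l(2))
  have "precedes (fibers js) (fiber js i) (fiber js j) \<longleftrightarrow>
      (\<exists>x y. x < y \<and> y < length l \<and> l ! x = i \<and> l ! y = j)"
    unfolding precedes_def fibers_def l_def[symmetric] using assms
    by (intro ex_cong1) (auto simp: inj mem)
  also have "\<dots> \<longleftrightarrow> i < j"
  proof
    assume "\<exists>x y. x < y \<and> y < length l \<and> l ! x = i \<and> l ! y = j"
    then show "i < j" using l(1) by (auto simp: sorted_wrt_iff_nth_less)
  next
    assume "i < j"
    obtain x y where xy: "x < length l" "l ! x = i" "y < length l" "l ! y = j"
      using assms unfolding l(2)[symmetric] in_set_conv_nth by blast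
    have "x < y"
    proof (rule ccontr)
      assume "\<not> x < y"
      then have "y < x \<or> x = y" by auto
      then have "l ! y \<le> l ! x"
        using l(1) xy by (auto simp: sorted_wrt_iff_nth_less less_imp_le)
      then show False using xy \<open>i < j\<close> by simp
    qed
    then show "\<exists>x y. x < y \<and> y < length l \<and> l ! x = i \<and> l ! y = j" using xy by blast
  qed
  finally show ?thesis .
qed

lemma covers_fiber:
  assumes "pairing js" "s < t" "t < length js" "js ! s = js ! t"
  shows "covers (fiber js i) (fiber js (js ! t)) \<longleftrightarrow>
    (\<exists>x y. x < s \<and> t < y \<and> y < length js \<and> js ! x = i \<and> js ! y = i)" (is "_ = ?R")
proof -
  have "covers (fiber js i) (fiber js (js ! t)) \<longleftrightarrow>
      (\<exists>x\<in>fiber js i. \<exists>y\<in>fiber js i. x < Suc s \<and> Suc t < y)"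
    unfolding covers_def pairing_fiber[OF assms] using \<open>s < t\<close>
    by (intro bex_cong refl) auto
  also have "\<dots> \<longleftrightarrow> ?R"
    using assms(2,3) by (fastforce simp: fiber_def)
  finally show ?thesis .
qed

text \<open>A position opened between \<open>s\<close> and \<open>t\<close> with its partner after
  \<open>t\<close> would cross the block. The open positions right after \<open>t\<close> are
  therefore the left ends of the blocks that cover it.\<close>

lemma open_below_iff:
  assumes pair: "pairing js" and nc: "noncrossing (fiber js ` set js)"
    and st: "s < t" "t < length js" "js ! s = js ! t"
  shows "x \<in> set (open_positions js (Suc t)) \<longleftrightarrow>
    x < s \<and> (\<exists>y>t. y < length js \<and> js ! y = js ! x)"
proof
  assume x: "x \<in> set (open_positions js (Suc t))"
  then obtain y where y: "x \<le> t" "y < length js" "t < y" "js ! y = js ! x"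
    by (auto simp: set_open_positions)
  have ne: "js ! x \<noteq> js ! t"
    using pairing_two[OF pair st, of y] y st(1) by auto
  have "x < s"
  proof (rule ccontr)
    assume "\<not> x < s"
    then have "s < x" "x < t"
      using ne st(3) y(1) by (metis linorder_neqE_nat, metis le_neq_implies_less)
    then show False using noncrossing_fibersD[OF nc, of s x t y] y st ne by simp
  qed
  then show "x < s \<and> (\<exists>y>t. y < length js \<and> js ! y = js ! x)" using y by blast
qed (use st(1) in \<open>auto simp: set_open_positions intro: less_imp_le Suc_leI\<close>)

text \<open>Among the covers, the block of \<open>m\<close> has the largest left end, so no cover
  lies inside it. Any other cover begins before \<open>m\<close> and by noncrossing ends after the
  block of \<open>m\<close>, which it thus covers, so it is not nearest; this gives the uniqueness
  that \<open>THE\<close> needs.\<close>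

lemma nearest_cover_fiber:
  assumes pair: "pairing js" and nc: "noncrossing (fiber js ` set js)"
    and st: "s < t" "t < length js" "js ! s = js ! t"
    and m: "open_positions js (Suc t) \<noteq> []" "m = hd (open_positions js (Suc t))"
  shows "nearest_cover (fibers js) (fiber js (js ! t)) = fiber js (js ! m)"
proof -
  note covers = covers_fiber[OF pair]
  note below = open_below_iff[OF pair nc st]
  have "m \<in> set (open_positions js (Suc t))" using m by simp
  then obtain y where y: "m < s" "t < y" "y < length js" "js ! y = js ! m"
    by (auto simp: below)
  have max: "x \<le> m" if "x < s" "t < q" "q < length js" "js ! q = js ! x" for x q
    using hd_open_positions_ge[of x js "Suc t"] that m(2) by (auto simp: below)
  have "m < y" "js ! m = js ! y" using y st(1) by auto
  note covers_m = covers[OF this(1) y(3) this(2), unfolded y(4)]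
  show ?thesis
    unfolding nearest_cover_def
  proof (rule the_equality)
    have "covers (fiber js (js ! m)) (fiber js (js ! t))"
      using y covers[OF st] by auto
    moreover have False
      if cov: "covers (fiber js i) (fiber js (js ! t))" "covers (fiber js (js ! m)) (fiber js i)" for i
    proof -
      obtain x q where xq: "x < s" "t < q" "q < length js" "js ! x = i" "js ! q = i"
        using iffD1[OF covers[OF st] cov(1)] by (elim exE conjE)
      then have "x < q" "js ! x = js ! q" using st(1) by auto
      from covers[OF this(1) xq(3) this(2), of "js ! m"] cov(2)
      obtain x' q' where x': "x' < x" "q < q'" "q' < length js" "js ! x' = js ! m" "js ! q' = js ! m"
        using xq by auto
      have "x \<le> m" using max[of x q] xq by auto
      then have "x' \<noteq> m" "x' \<noteq> y" using x' y st xq by auto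
      then show False
        using pairing_two[OF pair \<open>m < y\<close> y(3) \<open>js ! m = js ! y\<close>, of x'] x' y xq st by auto
    qed
    ultimately show "is_nearest_cover (fibers js) (fiber js (js ! t)) (fiber js (js ! m))"
      using y st by (auto simp: is_nearest_cover_def)
  next
    fix C assume C: "is_nearest_cover (fibers js) (fiber js (js ! t)) C"
    then obtain i where i: "i \<in> set js" "C = fiber js i" "covers (fiber js i) (fiber js (js ! t))"
      by (auto simp: is_nearest_cover_def)
    obtain x q where xq: "x < s" "t < q" "q < length js" "js ! x = i" "js ! q = i"
      using iffD1[OF covers[OF st] i(3)] by (elim exE conjE)
    have "x \<le> m" using max[of x q] xq by auto
    moreover have False if "x < m"
    proof -
      have "js ! x \<noteq> js ! m"
        using pairing_two[OF pair \<open>m < y\<close> y(3) \<open>js ! m = js ! y\<close>, of x] xq y that st by auto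
      then have "y \<noteq> q" using xq y by auto
      moreover have "\<not> q < y"
      proof
        assume "q < y"
        then show False
          using noncrossing_fibersD[OF nc, of x m q y] that xq y st \<open>js ! x \<noteq> js ! m\<close> by simp
      qed
      ultimately have "y < q" by auto
      then have "covers C (fiber js (js ! m))"
        using covers_m xq that i(2) by auto
      moreover have "covers (fiber js (js ! m)) (fiber js (js ! t))"
        using y covers[OF st] by auto
      moreover have "fiber js (js ! m) \<in> set (fibers js)"
        using imageI[OF nth_mem[OF y(3)], of "fiber js"] y(4) by simp
      ultimately show False using C unfolding is_nearest_cover_def by blast
    qed
    ultimately have "x = m" by (cases "x < m") auto
    then show "C = fiber js (js ! m)" using i(2) xq by simp
  qed
qed

text \<open>Each block is finished exactly once, so the positions in \<open>T\<close> index the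
  blocks through \<open>F\<close>; at all other positions the weight is \<open>1\<close>.\<close>

lemma prod_step_weight:
  assumes pair: "pairing js" and nc: "noncrossing (fiber js ` set js)"
  shows "(\<Prod>t<length js. step_weight u v w js t) =
    u ^ card (outer_blocks (fibers js)) * v ^ card (B_blocks (fibers js)) *
    w ^ card (C_blocks (fibers js))"
proof -
  define T where "T = {t. t < length js \<and> js ! t \<in> set (take t js)}"
  define m where "m t = hd (open_positions js (Suc t))" for t
  define Tu where "Tu = {t \<in> T. open_positions js (Suc t) = []}"
  define Tv where "Tv = {t \<in> T. open_positions js (Suc t) \<noteq> [] \<and> js ! m t < js ! t}"
  \<comment> \<open>Values of distinct blocks differ, so the negation here says that the block
    precedes its nearest cover.\<close>
  define Tw where "Tw = {t \<in> T. open_positions js (Suc t) \<noteq> [] \<and> \<not> js ! m t < js ! t}"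
  define F where "F t = fiber js (js ! t)" for t
  have [simp]: "finite T" "finite Tu" "finite Tv" "finite Tw"
    by (simp_all add: T_def Tu_def Tv_def Tw_def)
  have T: "t \<in> T \<longleftrightarrow> t < length js \<and> (\<exists>s<t. js ! s = js ! t)" for t
    by (auto simp: T_def in_set_take_iff)
  have partner: thesis if "t \<in> T"
    "\<And>s. s < t \<Longrightarrow> t < length js \<Longrightarrow> js ! s = js ! t \<Longrightarrow> thesis" for t thesis
    using that T by blast
  have inj: "inj_on F T"
  proof (rule inj_onI)
    fix t t' assume t: "t \<in> T" "t' \<in> T" and eq: "F t = F t'"
    then have same: "js ! t = js ! t'"
      using inj_onD[OF inj_on_fiber[of js], of "js ! t" "js ! t'"] by (auto simp: F_def T_def)
    obtain s s' where "s < t" "t < length js" "js ! s = js ! t"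
      and s': "s' < t'" "t' < length js" "js ! s' = js ! t'"
      using t T by metis
    then show "t = t'"
      using pairing_two[OF pair s', of t] pairing_two[OF pair s', of s] same by auto
  qed
  have image: "F ` T = fiber js ` set js"
  proof (intro equalityI subsetI)
    fix P assume "P \<in> fiber js ` set js"
    then obtain s where s: "s < length js" "P = fiber js (js ! s)"
      by (auto simp: in_set_conv_nth)
    obtain t where "t < length js" "t \<noteq> s" "js ! t = js ! s"
      using pairing_partner[OF pair s(1)] .
    then have "s < t \<and> t \<in> T \<or> t < s \<and> s \<in> T" "js ! t = js ! s"
      using s(1) T by (metis linorder_neqE_nat)+
    then show "P \<in> F ` T" using s(2) by (metis F_def imageI)
  qed (auto simp: F_def T_def)
  have below: "open_positions js (Suc t) \<noteq> [] \<longleftrightarrow> F t \<in> inner_blocks (fibers js)" if "t \<in> T" for t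
    using that
  proof (rule partner)
    fix s assume st: "s < t" "t < length js" "js ! s = js ! t"
    have "open_positions js (Suc t) \<noteq> [] \<longleftrightarrow> (\<exists>x. x \<in> set (open_positions js (Suc t)))"
      by (cases "open_positions js (Suc t)") auto
    also have "\<dots> \<longleftrightarrow> (\<exists>i. covers (fiber js i) (fiber js (js ! t)))"
      unfolding open_below_iff[OF pair nc st] covers_fiber[OF pair st] by auto
    also have "\<dots> \<longleftrightarrow> (\<exists>i\<in>set js. covers (fiber js i) (fiber js (js ! t)))"
      unfolding covers_fiber[OF pair st] by (metis nth_mem)
    finally show ?thesis using st(2) by (simp add: inner_blocks_def F_def)
  qed
  have nearest: "nearest_cover (fibers js) (F t) = fiber js (js ! m t)"
    "js ! m t \<in> set js" "js ! m t \<noteq> js ! t"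
    if t: "t \<in> T" "open_positions js (Suc t) \<noteq> []" for t
  proof -
    obtain s where st: "s < t" "t < length js" "js ! s = js ! t" using t(1) T by blast
    show "nearest_cover (fibers js) (F t) = fiber js (js ! m t)"
      unfolding F_def by (rule nearest_cover_fiber[OF pair nc st t(2) m_def])
    have "m t \<in> set (open_positions js (Suc t))" using t(2) by (simp add: m_def)
    then have m: "m t < s" unfolding open_below_iff[OF pair nc st] by blast
    with st show "js ! m t \<in> set js" by auto
    show "js ! m t \<noteq> js ! t" using pairing_two[OF pair st, of "m t"] m st by auto
  qed
  have prec:
    "precedes (fibers js) (nearest_cover (fibers js) (F t)) (F t) \<longleftrightarrow> js ! m t < js ! t"
    "precedes (fibers js) (F t) (nearest_cover (fibers js) (F t)) \<longleftrightarrow> \<not> js ! m t < js ! t"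
    if t: "t \<in> T" "open_positions js (Suc t) \<noteq> []" for t
  proof -
    have "js ! t \<in> set js" using t(1) T by auto
    then show
      "precedes (fibers js) (nearest_cover (fibers js) (F t)) (F t) \<longleftrightarrow> js ! m t < js ! t"
      "precedes (fibers js) (F t) (nearest_cover (fibers js) (F t)) \<longleftrightarrow> \<not> js ! m t < js ! t"
      unfolding nearest(1)[OF t] unfolding F_def using nearest(2,3)[OF t] by (auto simp: precedes_fibers)
  qed
  have inner: "inner_blocks (fibers js) \<subseteq> F ` T"
    by (auto simp: inner_blocks_def image)
  have "outer_blocks (fibers js) = F ` Tu"
  proof -
    have "outer_blocks (fibers js) = {P \<in> F ` T. P \<notin> inner_blocks (fibers js)}"
      by (auto simp: outer_blocks_def image)
    also have "\<dots> = F ` Tu" using below by (auto simp: Tu_def)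
    finally show ?thesis .
  qed
  moreover have "B_blocks (fibers js) = F ` Tv"
  proof -
    have "B_blocks (fibers js) = F ` {t \<in> T. F t \<in> inner_blocks (fibers js) \<and>
        precedes (fibers js) (nearest_cover (fibers js) (F t)) (F t)}"
      unfolding B_blocks_def using inner by blast
    also have "{t \<in> T. F t \<in> inner_blocks (fibers js) \<and>
        precedes (fibers js) (nearest_cover (fibers js) (F t)) (F t)} = Tv"
      unfolding Tv_def using below prec by blast
    finally show ?thesis .
  qed
  moreover have "C_blocks (fibers js) = F ` Tw"
  proof -
    have "C_blocks (fibers js) = F ` {t \<in> T. F t \<in> inner_blocks (fibers js) \<and>
        precedes (fibers js) (F t) (nearest_cover (fibers js) (F t))}"
      unfolding C_blocks_def using inner by blast
    also have "{t \<in> T. F t \<in> inner_blocks (fibers js) \<and>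
        precedes (fibers js) (F t) (nearest_cover (fibers js) (F t))} = Tw"
      unfolding Tw_def using below prec by blast
    finally show ?thesis .
  qed
  ultimately have cards: "card (outer_blocks (fibers js)) = card Tu"
    "card (B_blocks (fibers js)) = card Tv" "card (C_blocks (fibers js)) = card Tw"
    using inj by (auto simp: Tu_def Tv_def Tw_def intro!: card_image elim: inj_on_subset)
  have disj: "Tu \<inter> (Tv \<union> Tw) = {}" "Tv \<inter> Tw = {}"
    by (auto simp: Tu_def Tv_def Tw_def)
  have "(\<Prod>t<length js. step_weight u v w js t) = (\<Prod>t\<in>T. step_weight u v w js t)"
    by (rule prod.mono_neutral_right) (auto simp: T_def step_weight_def)
  also have "T = Tu \<union> (Tv \<union> Tw)" by (auto simp: Tu_def Tv_def Tw_def)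
  also have "(\<Prod>t\<in>Tu \<union> (Tv \<union> Tw). step_weight u v w js t) =
      (\<Prod>t\<in>Tu. step_weight u v w js t) * ((\<Prod>t\<in>Tv. step_weight u v w js t) *
       (\<Prod>t\<in>Tw. step_weight u v w js t))"
    by (simp add: prod.union_disjoint disj)
  also have "(\<Prod>t\<in>Tu. step_weight u v w js t) = (\<Prod>t\<in>Tu. u)"
    by (rule prod.cong) (auto simp: Tu_def T_def step_weight_def level_weight_def)
  also have "(\<Prod>t\<in>Tv. step_weight u v w js t) = (\<Prod>t\<in>Tv. v)"
    by (rule prod.cong)
       (auto simp: Tv_def T_def m_def step_weight_def level_weight_def neq_Nil_conv)
  also have "(\<Prod>t\<in>Tw. step_weight u v w js t) = (\<Prod>t\<in>Tw. w)"
    by (rule prod.cong)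
       (auto simp: Tw_def T_def m_def step_weight_def level_weight_def neq_Nil_conv)
  finally show ?thesis by (simp add: cards)
qed

section \<open>Values of pair words\<close>

context centred_alpha_free
begin

text \<open>All entries are bare generators: these are already centred, and a finished pair
  contributes only a scalar.\<close>

definition open_stack :: "'i list \<Rightarrow> nat \<Rightarrow> ('i \<times> 'a) list" where
  "open_stack js t = map (\<lambda>s. (js ! s, a (js ! s))) (open_positions js t)"

text \<open>A first occurrence is pushed unchanged, having mean zero. A second one squares the top
  letter; the centred square is stuck because its index does not return, so only the mean of the
  square remains, and the stack beneath selects it as \<open>u\<close>, \<open>v\<close> or
  \<open>w\<close>.\<close>

lemma pair_word_reduction:
  assumes chi: "\<chi> \<in> {\<phi>, \<psi>, \<theta>}" and pair: "pairing js" and I: "set js \<subseteq> I"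
    and sq: "\<And>i. i \<in> I \<Longrightarrow> \<chi> ((a i)^2) = u \<and> \<psi> ((a i)^2) = v \<and> \<theta> ((a i)^2) = w"
  shows "t \<le> length js \<Longrightarrow> (\<And>t'. t' < t \<Longrightarrow> closes_top js t') \<Longrightarrow>
    reduced \<chi> (open_stack js t) \<and>
    \<chi> (prod_list (map a js)) = (\<Prod>t'<t. step_weight u v w js t') *
      \<chi> (stack_prod (open_stack js t) * prod_list (map a (drop t js)))"
proof (induction t)
  case 0
  then show ?case by (simp add: open_stack_def)
next
  case (Suc t)
  then have t: "t < length js" by simp
  define j where "j = js ! t"
  define x where "x = prod_list (map a (drop (Suc t) js))"
  have j: "j \<in> I" using t I by (auto simp: j_def)
  have drop: "drop t js = j # drop (Suc t) js" using t by (simp add: j_def Cons_nth_drop_Suc)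
  have red: "reduced \<chi> (open_stack js t)"
    and IH: "\<chi> (prod_list (map a js)) = (\<Prod>t'<t. step_weight u v w js t') *
      \<chi> (stack_prod (open_stack js t) * a j * x)"
    using Suc by (simp_all add: drop x_def mult.assoc)
  show ?case
  proof (cases "j \<in> set (take t js)")
    case False
    have new: "open_stack js t = [] \<or> fst (hd (open_stack js t)) \<noteq> j"
    proof (cases "open_positions js t")
      case (Cons s ss)
      then have "s < t" using set_open_positions[of s js t] by auto
      then show ?thesis using False t Cons by (auto simp: open_stack_def j_def in_set_take_iff)
    qed (simp add: open_stack_def)
    have stack: "open_stack js (Suc t) = (j, a j) # open_stack js t"
      using open_positions_new[OF pair t] False by (simp add: open_stack_def j_def)
    note p = push[OF chi red j generator_in_generated new, unfolded top_functional_generator[OF chi j]]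
    have "step_weight u v w js t = 1" using False by (simp add: step_weight_def j_def)
    then show ?thesis using p(1) p(2)[of x] IH by (simp add: stack x_def)
  next
    case True
    obtain s where s: "s < t" "js ! s = j"
      and open_eq: "open_positions js t = s # open_positions js (Suc t)"
      using open_positions_close[OF pair t] True Suc.prems(2) by (auto simp: j_def)
    then have stack: "open_stack js t = (j, a j) # open_stack js (Suc t)"
      by (simp add: open_stack_def)
    define p where "p = open_stack js (Suc t)"
    have p: "reduced \<chi> p" "p = [] \<or> fst (hd p) \<noteq> j"
      using red stack by (simp_all add: p_def)
    have aa: "a j * a j \<in> alg j" by (simp add: generated_mult generator_in_generated)
    note push = push[OF chi p(1) j aa p(2)]
    have "j \<notin> set (drop (Suc t) js)"
      using pairing_two[OF pair s(1) t] s by (fastforce simp: in_set_drop_iff j_def)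
    then have "\<chi> (stack_prod ((j, a j * a j - sc (top_functional \<chi> (map fst p) j (a j * a j)) 1) # p)
        * x) = 0"
      unfolding x_def using I
      by (intro stuck_vanish[OF chi push(1), of j]) (auto dest: in_set_dropD)
    then have "\<chi> (stack_prod (open_stack js t) * a j * x) =
        top_functional \<chi> (map fst p) j (a j * a j) * \<chi> (stack_prod p * x)"
      using push(2)[of x] by (simp add: stack p_def mult.assoc)
    moreover have "top_functional \<chi> (map fst p) j (a j * a j) = step_weight u v w js t"
      using True sq[OF j]
      by (cases "open_positions js (Suc t)")
        (auto simp: step_weight_def level_weight_def p_def open_stack_def j_def power2_eq_square)
    ultimately show ?thesis using IH p by (simp add: p_def x_def)
  qed
qed

text \<open>Without crossings the word is read to its end, and the empty stack has value
  \<open>1\<close>. With a crossing, the earliest second occurrence that misses its partner is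
  pushed as a new letter, and it is stuck since both occurrences of its index are used up.\<close>

lemma pair_word:
  assumes chi: "\<chi> \<in> {\<phi>, \<psi>, \<theta>}" and pair: "pairing js" and I: "set js \<subseteq> I"
    and sq: "\<And>i. i \<in> I \<Longrightarrow> \<chi> ((a i)^2) = u \<and> \<psi> ((a i)^2) = v \<and> \<theta> ((a i)^2) = w"
  shows "\<chi> (prod_list (map a js)) =
    (if noncrossing (fiber js ` set js) then u ^ card (outer_blocks (fibers js)) *
       v ^ card (B_blocks (fibers js)) * w ^ card (C_blocks (fibers js)) else 0)"
proof (cases "noncrossing (fiber js ` set js)")
  case True
  then have "closes_top js t" if "t < length js" for t
    using that noncrossing_iff_closes_top[OF pair] by blast
  then have "\<chi> (prod_list (map a js)) = (\<Prod>t<length js. step_weight u v w js t)"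
    using pair_word_reduction[OF chi pair I sq, of "length js"] unital_functional_one[OF unital[OF chi]]
    by (simp add: open_stack_def)
  then show ?thesis using True by (simp add: prod_step_weight[OF pair True])
next
  case False
  define t where "t = (LEAST t. t < length js \<and> \<not> closes_top js t)"
  have "\<exists>t. t < length js \<and> \<not> closes_top js t"
    using False noncrossing_iff_closes_top[OF pair] by blast
  from LeastI_ex[OF this] have t: "t < length js" "\<not> closes_top js t"
    by (auto simp: t_def)
  have "closes_top js t'" if "t' < t" for t'
    using not_less_Least[of t' "\<lambda>t. t < length js \<and> \<not> closes_top js t"] that t(1)
    by (auto simp: t_def)
  then have red: "reduced \<chi> (open_stack js t)"
    and eq: "\<chi> (prod_list (map a js)) = (\<Prod>t'<t. step_weight u v w js t') *
      \<chi> (stack_prod (open_stack js t) * prod_list (map a (drop t js)))"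
    using pair_word_reduction[OF chi pair I sq, of t] t(1) by auto
  define j where "j = js ! t"
  have j: "j \<in> I" using t I by (auto simp: j_def)
  have new: "open_stack js t = [] \<or> fst (hd (open_stack js t)) \<noteq> j"
    using t(2) by (auto simp: closes_top_def open_stack_def j_def hd_map)
  note p = push[OF chi red j generator_in_generated new,
      unfolded top_functional_generator[OF chi j]]
  obtain s where s: "s < t" "js ! s = j"
    using t by (auto simp: closes_top_def j_def in_set_take_iff)
  then have "j \<notin> set (drop (Suc t) js)"
    using pairing_two[OF pair s(1) t(1)] by (fastforce simp: in_set_drop_iff j_def)
  then have "\<chi> (stack_prod ((j, a j - sc 0 1) # open_stack js t) *
      prod_list (map a (drop (Suc t) js))) = 0"
    using I by (intro stuck_vanish[OF chi p(1), of j]) (auto dest: in_set_dropD)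
  moreover have "drop t js = j # drop (Suc t) js"
    using t(1) by (simp add: j_def Cons_nth_drop_Suc)
  ultimately have "\<chi> (stack_prod (open_stack js t) * prod_list (map a (drop t js))) = 0"
    using p(2)[of "prod_list (map a (drop (Suc t) js))"] by (simp add: mult.assoc)
  then show ?thesis using eq False by simp
qed

end

section \<open>Counting words\<close>

lemma card_set_pairing:
  assumes "pairing js"
  shows "2 * card (set js) = length js"
proof -
  have "length js = (\<Sum>i\<in>set js. count_list js i)"
    by (simp add: sum_count_set)
  also have "\<dots> = 2 * card (set js)" using assms by (simp add: pairing_def)
  finally show ?thesis by simp
qed

lemma fibers_in_ONC_pair:
  assumes pair: "pairing js" and nc: "noncrossing (fiber js ` set js)"
  shows "fibers js \<in> ONC_pair (length js)"
proof -
  have "\<Union> (fiber js ` set js) = {1..length js}"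
  proof (intro equalityI subsetI)
    fix y assume "y \<in> {1..length js}"
    then obtain x where "y = Suc x" "x < length js" by (cases y) auto
    then show "y \<in> \<Union> (fiber js ` set js)" by auto
  qed (auto simp: fiber_def)
  moreover have "disjoint (fiber js ` set js)"
    by (rule disjointI) (auto simp: fiber_def)
  moreover have "{} \<notin> fiber js ` set js" using fiber_nonempty by fastforce
  moreover have "distinct (fibers js)"
    using inj_on_fiber by (simp add: fibers_def distinct_map)
  moreover have "card P = 2" if "P \<in> fiber js ` set js" for P
    using that pair by (auto simp: card_fiber pairing_def)
  ultimately show ?thesis
    using nc by (simp add: ONC_pair_def ONC_def ordered_set_partition_def partition_on_def)
qed

lemma length_ONC_pair:
  assumes "\<pi> \<in> ONC_pair n"
  shows "2 * length \<pi> = n"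
proof -
  have \<pi>: "distinct \<pi>" "partition_on {1..n} (set \<pi>)" "\<And>P. P \<in> set \<pi> \<Longrightarrow> card P = 2"
    using assms by (auto simp: ONC_pair_def ONC_def ordered_set_partition_def)
  have "n = card (\<Union> (set \<pi>))" using \<pi>(2) by (simp add: partition_on_def)
  also have "\<dots> = (\<Sum>P\<in>set \<pi>. card P)"
    by (rule card_Union_disjoint)
      (use \<pi> in \<open>auto simp: partition_on_def disjoint_def pairwise_def disjnt_def intro: card_ge_0_finite\<close>)
  also have "\<dots> = 2 * length \<pi>" using \<pi>(1,3) by (simp add: distinct_card)
  finally show ?thesis by simp
qed

definition nc_pair_words :: "'i set \<Rightarrow> nat \<Rightarrow> 'i list set" where
  "nc_pair_words X k =
     {js. length js = k \<and> set js \<subseteq> X \<and> pairing js \<and> noncrossing (fiber js ` set js)}"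

text \<open>Both words list the same values in increasing order, so equal block lists give equal
  fibers value by value.\<close>

lemma inj_on_fibers_set:
  "inj_on (\<lambda>js :: 'i::linorder list. (fibers js, set js)) {js. length js = k}"
proof (rule inj_onI, clarify)
  fix js js' :: "'i list"
  assume len: "length js' = length js" and eq: "fibers js = fibers js'" "set js = set js'"
  show "js = js'"
  proof (rule nth_equalityI)
    fix x assume x: "x < length js"
    then have "js ! x \<in> set js" by simp
    then have "fiber js (js ! x) = fiber js' (js ! x)" using eq by (auto simp: fibers_def)
    then show "js ! x = js' ! x" using x Suc_in_fiber[of x js "js ! x"] by simp
  qed (simp add: len)
qed

text \<open>The \<open>t\<close>-th block is labelled with the \<open>t\<close>-th smallest element
  of \<open>S\<close>, which makes the order of the blocks the order of their labels.\<close>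

lemma fibers_set_surj:
  assumes "finite S" "card S = length \<pi>" and \<pi>: "\<pi> \<in> ONC_pair k"
  obtains js where "js \<in> nc_pair_words S k" "fibers js = \<pi>" "set js = S"
proof -
  define l where "l = sorted_list_of_set S"
  have l: "distinct l" "set l = S" "length l = length \<pi>"
    using assms by (simp_all add: l_def)
  have part: "distinct \<pi>" "partition_on {1..k} (set \<pi>)" "noncrossing (set \<pi>)"
    "\<And>P. P \<in> set \<pi> \<Longrightarrow> card P = 2"
    using \<pi> by (auto simp: ONC_pair_def ONC_def ordered_set_partition_def)
  define idx where "idx x = (THE t. t < length \<pi> \<and> Suc x \<in> \<pi> ! t)" for x
  have unique: "t = t'" if "t < length \<pi>" "t' < length \<pi>" "y \<in> \<pi> ! t" "y \<in> \<pi> ! t'" for t t' y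
  proof -
    have "disjoint (set \<pi>)" using part(2) by (simp add: partition_on_def)
    from disjointD[OF this nth_mem[OF that(1)] nth_mem[OF that(2)]] have "\<pi> ! t = \<pi> ! t'"
      using that(3,4) by blast
    then show ?thesis using part(1) that by (simp add: nth_eq_iff_index_eq)
  qed
  have idx_eq: "idx x = t" if "t < length \<pi>" "Suc x \<in> \<pi> ! t" for x t
    unfolding idx_def using that unique by (intro the_equality) blast+
  have idx: "idx x < length \<pi>" "Suc x \<in> \<pi> ! idx x" if "x < k" for x
  proof -
    have "Suc x \<in> \<Union> (set \<pi>)" using part(2) that by (auto simp: partition_on_def)
    then obtain t where "t < length \<pi>" "Suc x \<in> \<pi> ! t" by (auto simp: in_set_conv_nth)
    then show "idx x < length \<pi>" "Suc x \<in> \<pi> ! idx x" using idx_eq by auto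
  qed
  define js where "js = map (\<lambda>x. l ! idx x) [0..<k]"
  have fiber_js: "fiber js (l ! t) = \<pi> ! t" if t: "t < length \<pi>" for t
  proof (intro equalityI subsetI)
    fix y assume "y \<in> fiber js (l ! t)"
    then obtain x where "y = Suc x" "x < k" "l ! idx x = l ! t"
      by (auto simp: fiber_def js_def)
    then show "y \<in> \<pi> ! t"
      using idx[of x] l t by (auto simp: nth_eq_iff_index_eq)
  next
    fix y assume y: "y \<in> \<pi> ! t"
    then have "y \<in> {1..k}" using part(2) t by (auto simp: partition_on_def)
    then obtain x where "y = Suc x" "x < k" by (cases y) auto
    then show "y \<in> fiber js (l ! t)" using idx_eq[OF t] y by (simp add: js_def)
  qed
  have set_js: "set js = S"
  proof (intro equalityI subsetI)
    fix i assume "i \<in> S"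
    then obtain t where t: "t < length \<pi>" "i = l ! t"
      using l by (metis in_set_conv_nth)
    have "\<pi> ! t \<in> set \<pi>" using t by simp
    then have "fiber js i \<noteq> {}"
      using part(2) unfolding t(2) fiber_js[OF t(1)] partition_on_def by metis
    then show "i \<in> set js" by (auto simp: fiber_def)
  qed (use idx(1) l in \<open>auto simp: js_def intro!: nth_mem[of _ l, unfolded l(2)]\<close>)
  have fibers_js: "fibers js = \<pi>"
    unfolding fibers_def set_js l_def[symmetric]
    by (rule nth_equalityI) (simp_all add: l fiber_js)
  have "pairing js"
    unfolding pairing_def
  proof
    fix i assume "i \<in> set js"
    then have "fiber js i \<in> set \<pi>" using set_fibers[of js] unfolding fibers_js by blast
    then show "count_list js i = 2" using part(4) card_fiber[of js i] by simp
  qed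
  moreover have "noncrossing (fiber js ` set js)"
    using part(3) unfolding set_fibers[symmetric] fibers_js .
  ultimately have "js \<in> nc_pair_words S k"
    by (simp add: nc_pair_words_def set_js) (simp add: js_def)
  then show thesis using that fibers_js set_js by blast
qed

lemma bij_betw_nc_pair_words:
  fixes X :: "'i::linorder set"
  assumes "finite X"
  shows "bij_betw (\<lambda>js. (fibers js, set js)) (nc_pair_words X (2 * p))
    (ONC_pair (2 * p) \<times> {S. S \<subseteq> X \<and> card S = p})"
  unfolding bij_betw_def
proof (intro conjI equalityI subsetI)
  show "inj_on (\<lambda>js. (fibers js, set js)) (nc_pair_words X (2 * p))"
    by (rule inj_on_subset[OF inj_on_fibers_set]) (auto simp: nc_pair_words_def)
next
  fix z assume "z \<in> (\<lambda>js. (fibers js, set js)) ` nc_pair_words X (2 * p)"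
  then obtain js where js: "z = (fibers js, set js)" "length js = 2 * p" "set js \<subseteq> X"
    "pairing js" "noncrossing (fiber js ` set js)"
    by (auto simp: nc_pair_words_def)
  then show "z \<in> ONC_pair (2 * p) \<times> {S. S \<subseteq> X \<and> card S = p}"
    using fibers_in_ONC_pair[OF js(4,5)] card_set_pairing[OF js(4)] by simp
next
  fix z assume "z \<in> ONC_pair (2 * p) \<times> {S. S \<subseteq> X \<and> card S = p}"
  then obtain \<pi> S where z: "z = (\<pi>, S)" "\<pi> \<in> ONC_pair (2 * p)" "S \<subseteq> X" "card S = p" by blast
  have "finite S" using assms z(3) by (rule rev_finite_subset)
  moreover have "card S = length \<pi>" using length_ONC_pair[OF z(2)] z(4) by simp
  ultimately obtain js where "js \<in> nc_pair_words S (2 * p)" "fibers js = \<pi>" "set js = S"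
    using fibers_set_surj z(2) by blast
  then show "z \<in> (\<lambda>js. (fibers js, set js)) ` nc_pair_words X (2 * p)"
    using z(1,3) by (intro image_eqI[of _ _ js]) (auto simp: nc_pair_words_def)
qed

text \<open>The summand depends on the partition alone, so each partition is counted once for every
  choice of its \<open>p\<close> values.\<close>

lemma sum_nc_pair_words:
  fixes X :: "'i::linorder set" and f :: "nat set list \<Rightarrow> complex"
  assumes "finite X"
  shows "(\<Sum>js\<in>nc_pair_words X (2 * p). f (fibers js)) =
    of_nat (card X choose p) * (\<Sum>\<pi>\<in>ONC_pair (2 * p). f \<pi>)"
proof -
  have "(\<Sum>js\<in>nc_pair_words X (2 * p). f (fibers js)) =
      (\<Sum>z\<in>ONC_pair (2 * p) \<times> {S. S \<subseteq> X \<and> card S = p}. f (fst z))"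
    using sum.reindex_bij_betw[OF bij_betw_nc_pair_words[OF assms, of p], of "\<lambda>z. f (fst z)"]
    by simp
  also have "\<dots> = (\<Sum>\<pi>\<in>ONC_pair (2 * p). \<Sum>S | S \<subseteq> X \<and> card S = p. f \<pi>)"
    by (subst sum.cartesian_product) (auto intro: sum.cong)
  also have "\<dots> = of_nat (card X choose p) * (\<Sum>\<pi>\<in>ONC_pair (2 * p). f \<pi>)"
    by (simp add: n_subsets[OF assms] sum_distrib_left)
  finally show ?thesis .
qed

section \<open>Expansion of powers into words, and words with few values\<close>

lemma power_sum_words:
  fixes a :: "'i \<Rightarrow> 'b::semiring_1"
  assumes "finite X"
  shows "(\<Sum>i\<in>X. a i) ^ k = (\<Sum>js | set js \<subseteq> X \<and> length js = k. prod_list (map a js))"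
proof (induction k)
  case 0
  have "{js. set js \<subseteq> X \<and> length js = 0} = {[]}" by auto
  then show ?case by simp
next
  case (Suc k)
  have eq: "{js. set js \<subseteq> X \<and> length js = Suc k} =
      (\<lambda>(i, js). i # js) ` (X \<times> {js. set js \<subseteq> X \<and> length js = k})"
    by (auto simp: length_Suc_conv image_iff)
  have inj: "inj_on (\<lambda>(i, js). i # js) (X \<times> {js. set js \<subseteq> X \<and> length js = k})"
    by (auto simp: inj_on_def)
  have "(\<Sum>i\<in>X. a i) ^ Suc k =
      (\<Sum>i\<in>X. \<Sum>js | set js \<subseteq> X \<and> length js = k. a i * prod_list (map a js))"
    by (simp add: Suc.IH sum_product)
  also have "\<dots> = (\<Sum>js | set js \<subseteq> X \<and> length js = Suc k. prod_list (map a js))"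
    unfolding eq by (subst sum.reindex[OF inj], subst sum.cartesian_product)
      (auto intro: sum.cong)
  finally show ?case .
qed

text \<open>Without singletons every value occurs at least twice, and in a word that is not a
  pairing some value occurs at least three times, so the length exceeds twice the number of
  values.\<close>

lemma not_pairing_cases:
  assumes "\<not> pairing js"
  obtains i where "count_list js i = 1" | "2 * card (set js) < length js"
proof (cases "\<exists>i. count_list js i = 1")
  case False
  then have two: "2 \<le> count_list js i" if "i \<in> set js" for i
    using that count_list_0_iff[of js i] by (metis One_nat_def less_2_cases not_less)
  obtain i where "i \<in> set js" "count_list js i \<noteq> 2"
    using assms by (auto simp: pairing_def)
  with two[of i] have "2 < count_list js i" by simp
  with two \<open>i \<in> set js\<close> have "(\<Sum>i\<in>set js. 2) < (\<Sum>i\<in>set js. count_list js i)"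
    by (intro sum_strict_mono_ex1) auto
  then show thesis using that(2) by (simp add: sum_count_set mult.commute)
qed (use that in blast)

text \<open>First the set of values is chosen, then a word over it.\<close>

lemma card_few_values:
  assumes "finite X"
  shows "card {js. set js \<subseteq> X \<and> length js = k \<and> card (set js) = d} \<le> card X ^ d * d ^ k"
proof -
  have "{js. set js \<subseteq> X \<and> length js = k \<and> card (set js) = d} \<subseteq>
      (\<Union>S\<in>{S. S \<subseteq> X \<and> card S = d}. {js. set js \<subseteq> S \<and> length js = k})" by auto
  moreover have fin: "finite {S. S \<subseteq> X \<and> card S = d}" using assms by simp
  moreover have "finite {js. set js \<subseteq> S \<and> length js = k}" if "S \<subseteq> X" for S
    using assms that by (intro finite_lists_length_eq) (rule finite_subset)
  ultimately have "card {js. set js \<subseteq> X \<and> length js = k \<and> card (set js) = d} \<le>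
      card (\<Union>S\<in>{S. S \<subseteq> X \<and> card S = d}. {js. set js \<subseteq> S \<and> length js = k})"
    by (intro card_mono) auto
  also have "\<dots> \<le> (\<Sum>S | S \<subseteq> X \<and> card S = d. card {js. set js \<subseteq> S \<and> length js = k})"
    by (rule card_UN_le[OF fin])
  also have "\<dots> = (\<Sum>S | S \<subseteq> X \<and> card S = d. d ^ k)"
    by (rule sum.cong) (use assms in \<open>auto simp: card_lists_length_eq finite_subset\<close>)
  also have "\<dots> = (card X choose d) * d ^ k" by (simp add: n_subsets[OF assms])
  also have "\<dots> \<le> card X ^ d * d ^ k"
    by (cases "d \<le> card X") (simp_all add: binomial_le_pow binomial_eq_0)
  finally show ?thesis .
qed

text \<open>From \<open>2 * d < k\<close> follows \<open>2 * d \<le> k - 1\<close>, so there are at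
  most a constant times \<open>sqrt n ^ (k - 1)\<close> such words, and one factor
  \<open>sqrt n\<close> is left in the denominator.\<close>

lemma few_values_negligible:
  "(\<lambda>n. real (card {js. set js \<subseteq> {1..n::nat} \<and> length js = k \<and> 2 * card (set js) < k}) / sqrt n ^ k)
    \<longlonglongrightarrow> 0"
proof (rule tendsto_sandwich[OF _ _ tendsto_const])
  let ?C = "\<Sum>d<k. real (d ^ k)"
  have le: "card {js. set js \<subseteq> {1..n} \<and> length js = k \<and> 2 * card (set js) < k} / sqrt n ^ k
      \<le> ?C / sqrt n" if n: "n \<ge> 1" for n :: nat
  proof -
    have k: "sqrt n ^ (2 * d) \<le> sqrt n ^ (k - 1)" if "2 * d < k" for d
      using n that by (intro power_increasing) auto
    have "{js. set js \<subseteq> {1..n} \<and> length js = k \<and> 2 * card (set js) < k} \<subseteq>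
        (\<Union>d\<in>{d. 2 * d < k}. {js. set js \<subseteq> {1..n} \<and> length js = k \<and> card (set js) = d})" by auto
    moreover have fin: "finite {d. 2 * d < k}" by (rule finite_subset[of _ "{..<k}"]) auto
    moreover have "finite {js. set js \<subseteq> {1..n} \<and> length js = k \<and> card (set js) = d}" for d
      by (rule finite_subset[OF _ finite_lists_length_eq[OF finite_atLeastAtMost[of 1 n], of k]]) auto
    ultimately have "card {js. set js \<subseteq> {1..n} \<and> length js = k \<and> 2 * card (set js) < k} \<le>
        card (\<Union>d\<in>{d. 2 * d < k}. {js. set js \<subseteq> {1..n} \<and> length js = k \<and> card (set js) = d})"
      by (intro card_mono) auto
    also have "\<dots> \<le> (\<Sum>d | 2 * d < k. card {js. set js \<subseteq> {1..n} \<and> length js = k \<and> card (set js) = d})"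
      by (rule card_UN_le[OF fin])
    also have "\<dots> \<le> (\<Sum>d | 2 * d < k. n ^ d * d ^ k)"
      using card_few_values[of "{1..n}" k] by (intro sum_mono) simp
    finally have "real (card {js. set js \<subseteq> {1..n} \<and> length js = k \<and> 2 * card (set js) < k})
        \<le> real (\<Sum>d | 2 * d < k. n ^ d * d ^ k)" by (rule of_nat_mono)
    also have "\<dots> = (\<Sum>d | 2 * d < k. sqrt n ^ (2 * d) * real (d ^ k))"
      by (simp add: power_mult)
    also have "\<dots> \<le> (\<Sum>d | 2 * d < k. sqrt n ^ (k - 1) * real (d ^ k))"
      using k by (intro sum_mono mult_right_mono) auto
    also have "\<dots> \<le> (\<Sum>d<k. sqrt n ^ (k - 1) * real (d ^ k))"
      by (intro sum_mono2) auto
    also have "\<dots> = sqrt n ^ (k - 1) * ?C" by (simp add: sum_distrib_left)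
    finally have "card {js. set js \<subseteq> {1..n} \<and> length js = k \<and> 2 * card (set js) < k} / sqrt n ^ k
        \<le> sqrt n ^ (k - 1) * ?C / sqrt n ^ k" by (intro divide_right_mono) simp_all
    \<comment> \<open>For \<open>k = 0\<close> the constant \<open>?C\<close> is an empty sum and
      both sides vanish.\<close>
    also have "\<dots> \<le> ?C / sqrt n"
      using n by (cases k) (simp_all add: field_simps)
    finally show ?thesis .
  qed
  show "\<forall>\<^sub>F n in sequentially. card {js. set js \<subseteq> {1..n} \<and> length js = k \<and> 2 * card (set js) < k} /
      sqrt n ^ k \<le> ?C / sqrt n"
    using eventually_ge_at_top[of 1] by eventually_elim (rule le)
  have "filterlim (\<lambda>n. sqrt (real n)) at_top sequentially"
    by (rule filterlim_compose[OF sqrt_at_top filterlim_real_sequentially])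
  then show "(\<lambda>n. ?C / sqrt n) \<longlonglongrightarrow> 0"
    by (rule tendsto_divide_0[OF tendsto_const filterlim_at_top_imp_at_infinity])
qed simp

text \<open>Passing from \<open>p\<close> to \<open>Suc p\<close> multiplies the quotient by
  \<open>(1 - p / n) / Suc p\<close>, which tends to \<open>1 / Suc p\<close>.\<close>

lemma binomial_over_power: "(\<lambda>n. real (n choose p) / real n ^ p) \<longlonglongrightarrow> 1 / fact p"
proof (induction p)
  case 0
  then show ?case by simp
next
  case (Suc p)
  have "(\<lambda>n. 1 - real p / real n) \<longlonglongrightarrow> 1 - 0"
    by (intro tendsto_diff tendsto_const lim_const_over_n)
  then have "(\<lambda>n. real (n choose p) / real n ^ p * ((1 - real p / real n) / real (Suc p)))
      \<longlonglongrightarrow> 1 / fact p * ((1 - 0) / real (Suc p))"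
    by (intro tendsto_mult[OF Suc.IH] tendsto_divide tendsto_const) auto
  moreover have "\<forall>\<^sub>F n in sequentially. real (n choose p) / real n ^ p *
      ((1 - real p / real n) / real (Suc p)) = real (n choose Suc p) / real n ^ Suc p"
    using eventually_ge_at_top[of "Suc p"]
  proof eventually_elim
    case (elim n)
    have "Suc p * (n choose Suc p) = (n - p) * (n choose p)"
      by (metis binomial_absorb_comp binomial_absorption diff_Suc_eq_diff_pred)
    then have "real (Suc p) * real (n choose Suc p) = (real n - real p) * real (n choose p)"
      using elim by (metis Suc_leD of_nat_diff of_nat_mult)
    then have "real (n choose Suc p) = (real n - real p) * real (n choose p) / real (Suc p)"
      by (simp add: field_simps)
    moreover have "1 - real p / real n = (real n - real p) / real n"
      using elim by (simp add: field_simps)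
    ultimately show ?case by (simp add: mult_ac)
  qed
  ultimately show ?case
    by (simp add: tendsto_cong algebra_simps)
qed

section \<open>The limit\<close>

lemma (in unital_complex_algebra) scale_power: "sc c x ^ k = sc (c ^ k) (x ^ k)"
  by (induction k) (simp_all add: scale_mult_left scale_mult_right)

text \<open>Here \<open>u\<close> is the second moment under \<chi>. Taking \<psi> or \<theta> for
  \<chi> replaces it by \<open>v\<close> or \<open>w\<close>, which is how the second and third
  limits arise from the formula of the first.\<close>

lemma moment_tendsto:
  fixes a :: "nat \<Rightarrow> 'a::ring_1"
  assumes "centred_alpha_free sc \<phi> \<psi> \<theta> {1..} a"
    and chi: "\<chi> \<in> {\<phi>, \<psi>, \<theta>}" and ident: "identically_distributed \<phi> \<psi> \<theta> {1..} a"
    and sq: "\<And>i. i \<in> {1..} \<Longrightarrow> \<chi> ((a i)^2) = u \<and> \<psi> ((a i)^2) = v \<and> \<theta> ((a i)^2) = w"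
  shows "(\<lambda>n. \<chi> (sc (complex_of_real (1 / sqrt (real n))) (\<Sum>i=1..n. a i) ^ k))
    \<longlonglongrightarrow> limit_moment u v w k"
proof -
  interpret centred_alpha_free sc \<phi> \<psi> \<theta> "{1..}" a by fact
  note \<chi> = unital[OF chi]
  show ?thesis
  proof (cases "k = 0")
    case True
    then show ?thesis
      by (simp add: limit_moment_def unital_functional_one[OF \<chi>])
  next
    case False
    define wt where "wt \<pi> = u ^ card (outer_blocks \<pi>) * v ^ card (B_blocks \<pi>) * w ^ card (C_blocks \<pi>)"
      for \<pi>
    define m where "m js = \<chi> (prod_list (map a js))" for js
    define words where "words n = {js. set js \<subseteq> {1..n} \<and> length js = k}" for n :: nat
    \<comment> \<open>\<open>M\<close> collects the pairings, of which only the noncrossing ones can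
      have a nonzero value; \<open>E\<close> is the rest.\<close>
    define M where "M n = (\<Sum>js\<in>nc_pair_words {1..n} k. wt (fibers js)) / of_real (sqrt n ^ k)"
      for n :: nat
    define E where "E n = (\<Sum>js | js \<in> words n \<and> \<not> pairing js. m js) / of_real (sqrt n ^ k)"
      for n :: nat
    have fin: "finite (words n)" for n
      unfolding words_def by (rule finite_lists_length_eq) simp
    have I: "set js \<subseteq> {1..}" if "js \<in> words n" for js n
      using that by (auto simp: words_def)
    have split: "\<chi> (sc (complex_of_real (1 / sqrt n)) (\<Sum>i=1..n. a i) ^ k) = M n + E n" for n
    proof -
      have "\<chi> (sc (complex_of_real (1 / sqrt n)) (\<Sum>i=1..n. a i) ^ k) =
          (\<Sum>js\<in>words n. m js) / of_real (sqrt n ^ k)"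
        by (simp add: scale_power power_sum_words words_def m_def unital_functional_scale[OF \<chi>]
            unital_functional_sum[OF \<chi>] power_divide)
      also have "(\<Sum>js\<in>words n. m js) =
          (\<Sum>js | js \<in> words n \<and> pairing js. m js) + (\<Sum>js | js \<in> words n \<and> \<not> pairing js. m js)"
        using sum.Int_Diff[OF fin, of m n "Collect pairing"]
        by (simp add: Int_def set_diff_eq)
      also have "(\<Sum>js | js \<in> words n \<and> pairing js. m js) =
          (\<Sum>js | js \<in> words n \<and> pairing js.
            if noncrossing (fiber js ` set js) then wt (fibers js) else 0)"
        unfolding m_def wt_def
        by (intro sum.cong refl pair_word[OF chi _ _ sq]) (use I in auto)
      also have "\<dots> = (\<Sum>js\<in>nc_pair_words {1..n} k. wt (fibers js))"
      proof (rule sum.mono_neutral_cong_right)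
        show "finite {js. js \<in> words n \<and> pairing js}" using fin[of n] by simp
      qed (auto simp: nc_pair_words_def words_def)
      finally show ?thesis by (simp add: M_def E_def add_divide_distrib)
    qed
    obtain B where B: "\<And>js. length js = k \<Longrightarrow> set js \<subseteq> {1..} \<Longrightarrow> cmod (m js) \<le> B"
      using word_bounded[OF chi ident, of k] unfolding m_def by blast
    have E: "E \<longlonglongrightarrow> 0"
    proof (rule tendsto_0_le[OF few_values_negligible[of k]])
      let ?few = "\<lambda>n. {js. set js \<subseteq> {1..n} \<and> length js = k \<and> 2 * card (set js) < k}"
      show "\<forall>\<^sub>F n in sequentially. cmod (E n) \<le> norm (card (?few n) / sqrt n ^ k) * B"
      proof (rule always_eventually, rule allI)
        fix n :: nat
        have few: "finite (?few n)"
          by (rule finite_subset[OF _ fin[of n]]) (auto simp: words_def)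
        \<comment> \<open>Outside \<open>?few\<close>, a word that is not a pairing has an index
          occurring exactly once.\<close>
        have "m js = 0" if js: "js \<in> words n" "\<not> pairing js" "js \<notin> ?few n" for js
          using js(2)
        proof (cases rule: not_pairing_cases)
          case (1 i)
          then show ?thesis
            unfolding m_def by (intro singleton_word_vanish[OF chi] I[OF js(1)])
        qed (use js in \<open>auto simp: words_def\<close>)
        then have "cmod (\<Sum>js | js \<in> words n \<and> \<not> pairing js. m js) =
            cmod (\<Sum>js | js \<in> words n \<and> \<not> pairing js \<and> js \<in> ?few n. m js)"
          using fin by (intro arg_cong[of _ _ cmod] sum.mono_neutral_right) auto
        also have "\<dots> \<le> (\<Sum>js | js \<in> words n \<and> \<not> pairing js \<and> js \<in> ?few n. B)"
          using B I by (intro sum_norm_le) (auto simp: words_def)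
        \<comment> \<open>Enlarging the index set needs \<open>0 \<le> B\<close>, which the bound at
          the word with all indices \<open>1\<close> supplies.\<close>
        also have "\<dots> \<le> (\<Sum>js\<in>?few n. B)"
          using few order_trans[OF norm_ge_zero B, of "replicate k 1"]
          by (intro sum_mono2) auto
        finally have "cmod (\<Sum>js | js \<in> words n \<and> \<not> pairing js. m js) \<le> card (?few n) * B"
          by simp
        from divide_right_mono[OF this, of "sqrt n ^ k"]
        show "cmod (E n) \<le> norm (card (?few n) / sqrt n ^ k) * B"
          by (simp add: E_def norm_divide norm_power mult.commute)
      qed
    qed
    have "M \<longlonglongrightarrow> limit_moment u v w k"
    proof (cases "even k")
      case True
      then obtain p where k: "k = 2 * p" by blast
      have "M = (\<lambda>n. of_real (real (n choose p) / real n ^ p) * (\<Sum>\<pi>\<in>ONC_pair k. wt \<pi>))"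
        by (rule ext) (simp add: M_def k sum_nc_pair_words power_mult)
      moreover have "\<dots> \<longlonglongrightarrow> of_real (1 / fact p) * (\<Sum>\<pi>\<in>ONC_pair k. wt \<pi>)"
        by (intro tendsto_intros binomial_over_power)
      moreover have "limit_moment u v w k = of_real (1 / fact p) * (\<Sum>\<pi>\<in>ONC_pair k. wt \<pi>)"
        using \<open>k \<noteq> 0\<close> by (simp add: limit_moment_def k wt_def sum_distrib_left mult.assoc)
      ultimately show ?thesis by simp
    next
      case odd: False
      then have "nc_pair_words {1..n} k = {}" for n :: nat
        using card_set_pairing by (fastforce simp: nc_pair_words_def)
      then have "M = (\<lambda>n. 0)" by (simp add: M_def fun_eq_iff)
      then show ?thesis using odd \<open>k \<noteq> 0\<close> by (simp add: limit_moment_def)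
    qed
    from tendsto_add[OF this E] show ?thesis unfolding split by simp
  qed
qed

theorem proposition6p5:
  fixes sc :: "complex \<Rightarrow> 'a::ring_1 \<Rightarrow> 'a"
    and \<phi> \<psi> \<theta> :: "'a \<Rightarrow> complex"
    and a :: "nat \<Rightarrow> 'a"
    and u v w :: complex
    and s :: "nat \<Rightarrow> 'a"
  assumes "three_prob_space sc \<phi> \<psi> \<theta>"
    and "identically_distributed \<phi> \<psi> \<theta> {1..} a"
    and "alpha_free sc \<phi> \<psi> \<theta> {1..} a"
    and "\<And>i. i \<ge> 1 \<Longrightarrow> \<phi> (a i) = 0 \<and> \<psi> (a i) = 0 \<and> \<theta> (a i) = 0"
    and "\<And>i. i \<ge> 1 \<Longrightarrow> u = \<phi> ((a i)^2) \<and> v = \<psi> ((a i)^2) \<and> w = \<theta> ((a i)^2)"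
    and "\<And>n. n \<ge> 1 \<Longrightarrow> s n = sc (complex_of_real (1 / sqrt (real n))) (\<Sum>i=1..n. a i)"
  shows "converges3 (\<lambda>n. distr3 \<phi> \<psi> \<theta> (s n)) (limit_lambda u v w, limit_mu v w, limit_nu v w)"
proof -
  interpret three_prob_space sc \<phi> \<psi> \<theta> by fact
  have free: "centred_alpha_free sc \<phi> \<psi> \<theta> {1..} a"
    by unfold_locales (use assms(3,4) in auto)
  \<comment> \<open>\<open>s 0\<close> is arbitrary, so the two sequences are compared from
    \<open>n = 1\<close> on.\<close>
  have s: "\<forall>\<^sub>F n in sequentially.
      \<chi> (sc (complex_of_real (1 / sqrt (real n))) (\<Sum>i=1..n. a i) ^ k) = \<chi> (s n ^ k)"
    for \<chi> :: "'a \<Rightarrow> complex" and k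
    using eventually_ge_at_top[of 1] by eventually_elim (simp add: assms(6))
  have "(\<lambda>n. \<phi> (s n ^ k)) \<longlonglongrightarrow> limit_moment u v w k"
    "(\<lambda>n. \<psi> (s n ^ k)) \<longlonglongrightarrow> limit_moment v v w k"
    "(\<lambda>n. \<theta> (s n ^ k)) \<longlonglongrightarrow> limit_moment w v w k" for k
    by (rule Lim_transform_eventually[OF moment_tendsto[OF free _ assms(2)] s];
        use assms(5) in auto)+
  then show ?thesis
    by (simp add: distr3_def distr_def limit_lambda_def limit_mu_def limit_nu_def)
qed

end
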